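(* Let $\Bbbk$ be a field of characteristic zero and $R=\Bbbk[u_1,\ldots,u_m]$. Let $\alpha=(\alpha_{ij}),\alpha'=(\alpha'_{ij})\in M_{m\times n}(\Bbbk)$, let $p=(p_1,\ldots,p_n)$ and $p'=(p_1',\ldots,p_n')$ be $n$-tuples of nonzero monic elements of $R$, and let $\sigma_i,\sigma_i'\in\operatorname{Aut}_\Bbbk(R)$ be given by $\sigma_i(u_j)=u_j-\alpha_{ji}$ and $\sigma_i'(u_j)=u_j-\alpha'_{ji}$. Suppose that $(R,\sigma,p)$ and $(R,\sigma',p')$ are consistent twisted generalized Weyl data. Then the twisted generalized Weyl algebras $A=\mathcal{A}(R,\sigma,p)$ and $A'=\mathcal{A}(R,\sigma',p')$ are isomorphic as graded $\Bbbk$-algebras if and only if $(\alpha,p)$ and $(\alpha',p')$ are equivalent.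
   Context: Fix a monomial order on $R$ (e.g. lexicographic); a nonzero polynomial is monic if its leading monomial has coefficient $1$. Equivalence of pairs: $(\alpha,p)$ and $(\alpha',p')$ are equivalent if there is a ($\Bbbk$-algebra) automorphism $\psi$ of $R$ such that $\psi\circ\sigma_i=\sigma_i'\circ\psi$ and $\psi(p_i)\in\Bbbk^\times\cdot p_i'$ for all $1\le i\le n$. A twisted generalized Weyl datum (TGWD) of rank $n$ is a triple $(R,\sigma,t)$ where $R$ is a ring, $\sigma=(\sigma_1^{1/2},\ldots,\sigma_n^{1/2})$ is an $n$-tuple of commuting ring automorphisms of $R$ and $t=(t_1,\ldots,t_n)$ is an $n$-tuple of nonzero central elements; $\sigma_i=(\sigma_i^{1/2})^2$. Here the square roots used are $\sigma_i^{1/2}(u_j)=u_j-\frac12\alpha_{ji}$ (and similarly for $\sigma'$ with $\alpha'$). The TGWD is consistent if $\sigma_j^{1/2}(t_i)\,\sigma_i^{1/2}(t_j)=\sigma_j^{-1/2}(t_i)\,\sigma_i^{-1/2}(t_j)$ for all $i\ne j$, and $\sigma_i^{1/2}\sigma_j^{1/2}(t_k)\,\sigma_i^{-1/2}\sigma_j^{-1/2}(t_k)=\sigma_i^{1/2}\sigma_j^{-1/2}(t_k)\,\sigma_i^{-1/2}\sigma_j^{1/2}(t_k)$ for all $i\ne j\ne k\ne i$. The twisted generalized Weyl construction $\mathcal{C}(R,\sigma,t)$ is the $\mathbb{Z}^n$-graded $R$-ring (ring equipped with a ring homomorphism from $R$) generated by $X_1^\pm,\ldots,X_n^\pm$ subject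 to $X_i^\pm X_i^\mp=\sigma_i^{\pm1/2}(t_i)1$; $X_i^\pm X_j^\mp=X_j^\mp X_i^\pm$ for $i\ne j$; $X_i^\pm\sigma_i^{\mp1/2}(r)=\sigma_i^{\pm1/2}(r)X_i^\pm$ for all $r\in R$; with $\deg X_i^\pm=\pm\boldsymbol{e}_i$ and $\deg(r1)=\boldsymbol{0}$ for $r\in R$, where $\boldsymbol e_1,\dots,\boldsymbol e_n$ is the standard basis of $\mathbb{Z}^n$. The twisted generalized Weyl algebra $\mathcal{A}(R,\sigma,t)$ is $\mathcal{C}(R,\sigma,t)/\mathcal{I}$ where $\mathcal{I}$ is the sum of all graded ideals $J=\bigoplus_{\boldsymbol{d}\in\mathbb{Z}^n}J_{\boldsymbol{d}}$ with $J_{\boldsymbol{0}}=\{0\}$. A graded $\Bbbk$-algebra isomorphism is a $\Bbbk$-algebra isomorphism mapping $A_{\boldsymbol d}$ to $A'_{\boldsymbol d}$ for all $\boldsymbol d\in\mathbb{Z}^n$. *)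

theory Defs
  imports
    "HOL-Library.Poly_Mapping"
    "HOL-Analysis.Finite_Cartesian_Product"
    "HOL-Algebra.Algebraic_Closure_Type"
begin

section \<open>Polynomial rings in finitely many variables\<close>

text \<open>The variables are indexed by a finite type \<open>'m\<close>, monomials are exponent vectors.\<close>

type_synonym ('m, 'k) mpoly = "('m \<Rightarrow>\<^sub>0 nat) \<Rightarrow>\<^sub>0 'k"

definition Const :: "'k::zero \<Rightarrow> ('m, 'k) mpoly"
  where "Const c = Poly_Mapping.single 0 c"

definition Var :: "'m \<Rightarrow> ('m, 'k::zero_neq_one) mpoly"
  where "Var j = Poly_Mapping.single (Poly_Mapping.single j 1) 1"

definition monomial_order :: "('m \<Rightarrow>\<^sub>0 nat) rel \<Rightarrow> bool"
  where "monomial_order ord \<longleftrightarrow>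
    well_order_on UNIV ord \<and> (\<forall>a b c. (a, b) \<in> ord \<longrightarrow> (a + c, b + c) \<in> ord)"

definition leading_monomial :: "('m \<Rightarrow>\<^sub>0 nat) rel \<Rightarrow> ('m, 'k::zero) mpoly \<Rightarrow> ('m \<Rightarrow>\<^sub>0 nat)"
  where "leading_monomial ord p =
    (THE a. a \<in> Poly_Mapping.keys p \<and> (\<forall>b \<in> Poly_Mapping.keys p. (b, a) \<in> ord))"

definition monic :: "('m \<Rightarrow>\<^sub>0 nat) rel \<Rightarrow> ('m, 'k::zero_neq_one) mpoly \<Rightarrow> bool"
  where "monic ord p \<longleftrightarrow>
    p \<noteq> 0 \<and> Poly_Mapping.lookup p (leading_monomial ord p) = 1"

definition ring_automorphism :: "('r::ring_1 \<Rightarrow> 'r) \<Rightarrow> bool"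
  where "ring_automorphism \<psi> \<longleftrightarrow> bij \<psi> \<and> \<psi> 1 = 1 \<and>
    (\<forall>r s. \<psi> (r + s) = \<psi> r + \<psi> s) \<and> (\<forall>r s. \<psi> (r * s) = \<psi> r * \<psi> s)"

definition algebra_automorphism ::
    "(('m, 'k::comm_ring_1) mpoly \<Rightarrow> ('m, 'k) mpoly) \<Rightarrow> bool"
  where "algebra_automorphism \<psi> \<longleftrightarrow>
    ring_automorphism \<psi> \<and> (\<forall>c. \<psi> (Const c) = Const c)"

text \<open>The algebra automorphism \<open>u\<^sub>j \<mapsto> u\<^sub>j - v\<^sub>j\<close>, written out as a substitution.\<close>

definition translation ::
    "('m::finite \<Rightarrow> 'k::comm_ring_1) \<Rightarrow> ('m, 'k) mpoly \<Rightarrow> ('m, 'k) mpoly"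
  where "translation v p =
    (\<Sum>a \<in> Poly_Mapping.keys p. Const (Poly_Mapping.lookup p a) *
        (\<Prod>j \<in> UNIV. (Var j - Const (v j)) ^ Poly_Mapping.lookup a j))"

lemma translation_Var: "translation v (Var j) = Var j - Const (v j)"
proof -
  have "(\<Prod>i\<in>UNIV. (Var i - Const (v i)) ^ Poly_Mapping.lookup (Poly_Mapping.single j 1) i)
      = (\<Prod>i\<in>UNIV. if i = j then Var i - Const (v i) else 1)"
    by (intro prod.cong) (auto simp: lookup_single when_def)
  then show ?thesis
    by (simp add: translation_def Var_def [of j, where 'k = 'b] Const_def [of "1 :: 'b"]
        flip: single_one)
      (simp add: Var_def)
qed

lemma translation_Const: "translation v (Const c) = Const c"
  by (cases "c = 0") (simp_all add: translation_def Const_def)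

text \<open>
  A matrix \<open>\<alpha> :: 'k ^ 'n ^ 'm\<close> has rows indexed by \<open>'m\<close> and columns by \<open>'n\<close>,
  so that \<open>\<alpha> $ j $ i\<close> is the entry \<open>\<alpha>\<^sub>j\<^sub>i\<close>.
\<close>

definition shift :: "'k::field ^ 'n ^ 'm::finite \<Rightarrow> 'n \<Rightarrow> ('m, 'k) mpoly \<Rightarrow> ('m, 'k) mpoly"
  where "shift \<alpha> i = translation (\<lambda>j. \<alpha> $ j $ i)"

definition half_shift :: "'k::field ^ 'n ^ 'm::finite \<Rightarrow> 'n \<Rightarrow> ('m, 'k) mpoly \<Rightarrow> ('m, 'k) mpoly"
  where "half_shift \<alpha> i = translation (\<lambda>j. \<alpha> $ j $ i / 2)"

definition equivalent_pairs ::
    "'k::field ^ 'n ^ 'm::finite \<Rightarrow> ('n \<Rightarrow> ('m, 'k) mpoly) \<Rightarrow>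
     'k ^ 'n ^ 'm \<Rightarrow> ('n \<Rightarrow> ('m, 'k) mpoly) \<Rightarrow> bool"
  where "equivalent_pairs \<alpha> p \<alpha>' p' \<longleftrightarrow>
    (\<exists>\<psi>. algebra_automorphism \<psi> \<and>
      (\<forall>i. \<psi> \<circ> shift \<alpha> i = shift \<alpha>' i \<circ> \<psi> \<and>
           (\<exists>c. c \<noteq> 0 \<and> \<psi> (p i) = Const c * p' i)))"


section \<open>Twisted generalized Weyl data\<close>

text \<open>
  Throughout, \<open>h i\<close> plays the role of \<open>\<sigma>\<^sub>i\<^sup>1\<^sup>/\<^sup>2\<close>; the rank is the cardinality of \<open>'n\<close>.
\<close>

datatype sign = Pos | Neg

fun opp :: "sign \<Rightarrow> sign" where
  "opp Pos = Neg"
| "opp Neg = Pos"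

text \<open>\<open>half h Pos i = \<sigma>\<^sub>i\<^sup>1\<^sup>/\<^sup>2\<close> and \<open>half h Neg i = \<sigma>\<^sub>i\<^sup>-\<^sup>1\<^sup>/\<^sup>2\<close>.\<close>

fun half :: "('n \<Rightarrow> 'r \<Rightarrow> 'r) \<Rightarrow> sign \<Rightarrow> 'n \<Rightarrow> 'r \<Rightarrow> 'r" where
  "half h Pos i = h i"
| "half h Neg i = inv_into UNIV (h i)"

definition tgw_datum :: "('n \<Rightarrow> 'r::ring_1 \<Rightarrow> 'r) \<Rightarrow> ('n \<Rightarrow> 'r) \<Rightarrow> bool"
  where "tgw_datum h t \<longleftrightarrow>
    (\<forall>i. ring_automorphism (h i)) \<and> (\<forall>i j. h i \<circ> h j = h j \<circ> h i) \<and>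
    (\<forall>i. t i \<noteq> 0 \<and> (\<forall>r. t i * r = r * t i))"

definition consistent :: "('n \<Rightarrow> 'r::ring_1 \<Rightarrow> 'r) \<Rightarrow> ('n \<Rightarrow> 'r) \<Rightarrow> bool"
  where "consistent h t \<longleftrightarrow>
    (\<forall>i j. i \<noteq> j \<longrightarrow>
      half h Pos j (t i) * half h Pos i (t j) = half h Neg j (t i) * half h Neg i (t j)) \<and>
    (\<forall>i j k. i \<noteq> j \<and> j \<noteq> k \<and> k \<noteq> i \<longrightarrow>
      half h Pos i (half h Pos j (t k)) * half h Neg i (half h Neg j (t k)) =
      half h Pos i (half h Neg j (t k)) * half h Neg i (half h Pos j (t k)))"


section \<open>Free rings\<close>

text \<open>
  Words form the free monoid, written additively so that \<open>'g word \<Rightarrow>\<^sub>0 int\<close>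
  is its monoid ring, i.e. the free (noncommutative) ring on \<open>'g\<close>.
\<close>

datatype 'g word = Word (letters: "'g list")

instantiation word :: (type) monoid_add
begin

definition zero_word :: "'a word"
  where "0 = Word []"

definition plus_word :: "'a word \<Rightarrow> 'a word \<Rightarrow> 'a word"
  where "v + w = Word (letters v @ letters w)"

instance
  by standard (simp_all add: zero_word_def plus_word_def)

end

type_synonym 'g free_ring = "'g word \<Rightarrow>\<^sub>0 int"

definition gen :: "'g \<Rightarrow> 'g free_ring"
  where "gen g = Poly_Mapping.single (Word [g]) 1"


section \<open>The twisted generalized Weyl construction\<close>

text \<open>
  As \<open>R\<close> is not central, the \<open>R\<close>-ring generated by the \<open>X\<^sub>i\<^sup>\<plusminus>\<close> is presented as the ring
  generated by \<open>R\<close> (the letters \<open>Coef r\<close>) and the \<open>X\<^sub>i\<^sup>\<plusminus>\<close> (the letters \<open>Xgen e i\<close>), with the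
  first three families of relations making \<open>Coef\<close> a unital ring homomorphism.
\<close>

datatype ('n, 'r) letter = Coef 'r | Xgen sign 'n

inductive_set tgw_relations ::
    "('n \<Rightarrow> 'r::ring_1 \<Rightarrow> 'r) \<Rightarrow> ('n \<Rightarrow> 'r) \<Rightarrow> ('n, 'r) letter free_ring set"
  for h :: "'n \<Rightarrow> 'r \<Rightarrow> 'r" and t :: "'n \<Rightarrow> 'r"
  where
    coef_one: "gen (Coef 1) - 1 \<in> tgw_relations h t"
  | coef_add: "gen (Coef (r + s)) - (gen (Coef r) + gen (Coef s)) \<in> tgw_relations h t"
  | coef_mult: "gen (Coef (r * s)) - gen (Coef r) * gen (Coef s) \<in> tgw_relations h t"
  | X_same: "gen (Xgen e i) * gen (Xgen (opp e) i) - gen (Coef (half h e i (t i)))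
      \<in> tgw_relations h t"
  | X_distinct: "i \<noteq> j \<Longrightarrow>
      gen (Xgen e i) * gen (Xgen (opp e) j) - gen (Xgen (opp e) j) * gen (Xgen e i) \<in> tgw_relations h t"
  | X_coef: "gen (Xgen e i) * gen (Coef (half h (opp e) i r))
      - gen (Coef (half h e i r)) * gen (Xgen e i) \<in> tgw_relations h t"

definition tgw_relation_ideal ::
    "('n \<Rightarrow> 'r::ring_1 \<Rightarrow> 'r) \<Rightarrow> ('n \<Rightarrow> 'r) \<Rightarrow> ('n, 'r) letter free_ring set"
  where "tgw_relation_ideal h t = genideal ring_of_type_algebra (tgw_relations h t)"

definition TGWC ::
    "('n \<Rightarrow> 'r::ring_1 \<Rightarrow> 'r) \<Rightarrow> ('n \<Rightarrow> 'r) \<Rightarrow> ('n, 'r) letter free_ring set ring"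
  where "TGWC h t = ring_of_type_algebra Quot tgw_relation_ideal h t"

definition TGWC_class ::
    "('n \<Rightarrow> 'r::ring_1 \<Rightarrow> 'r) \<Rightarrow> ('n \<Rightarrow> 'r) \<Rightarrow> ('n, 'r) letter free_ring \<Rightarrow>
     ('n, 'r) letter free_ring set"
  where "TGWC_class h t f = tgw_relation_ideal h t +>\<^bsub>ring_of_type_algebra\<^esub> f"

fun letter_degree :: "('n, 'r) letter \<Rightarrow> int ^ 'n" where
  "letter_degree (Coef r) = 0"
| "letter_degree (Xgen Pos i) = axis i 1"
| "letter_degree (Xgen Neg i) = - axis i 1"

definition word_degree :: "('n, 'r) letter word \<Rightarrow> int ^ 'n"
  where "word_degree w = sum_list (map letter_degree (letters w))"

definition TGWC_component ::
    "('n \<Rightarrow> 'r::ring_1 \<Rightarrow> 'r) \<Rightarrow> ('n \<Rightarrow> 'r) \<Rightarrow> int ^ 'n \<Rightarrow> ('n, 'r) letter free_ring set set"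
  where "TGWC_component h t d =
    TGWC_class h t ` {f. \<forall>w \<in> Poly_Mapping.keys f. word_degree w = d}"


section \<open>The twisted generalized Weyl algebra\<close>

definition graded_ideal ::
    "('n::finite \<Rightarrow> 'r::ring_1 \<Rightarrow> 'r) \<Rightarrow> ('n \<Rightarrow> 'r) \<Rightarrow> ('n, 'r) letter free_ring set set \<Rightarrow> bool"
  where "graded_ideal h t J \<longleftrightarrow> ideal J (TGWC h t) \<and>
    (\<forall>x \<in> J. \<exists>D y. finite D \<and> (\<forall>d \<in> D. y d \<in> J \<inter> TGWC_component h t d) \<and>
      x = finsum (TGWC h t) y D)"

definition TGW_radical_family ::
    "('n::finite \<Rightarrow> 'r::ring_1 \<Rightarrow> 'r) \<Rightarrow> ('n \<Rightarrow> 'r) \<Rightarrow> ('n, 'r) letter free_ring set set set"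
  where "TGW_radical_family h t =
    {J. graded_ideal h t J \<and> J \<inter> TGWC_component h t 0 = {\<zero>\<^bsub>TGWC h t\<^esub>}}"

definition TGW_radical ::
    "('n::finite \<Rightarrow> 'r::ring_1 \<Rightarrow> 'r) \<Rightarrow> ('n \<Rightarrow> 'r) \<Rightarrow> ('n, 'r) letter free_ring set set"
  where "TGW_radical h t =
    {finsum (TGWC h t) y \<J> | \<J> y.
       finite \<J> \<and> \<J> \<subseteq> TGW_radical_family h t \<and> (\<forall>J \<in> \<J>. y J \<in> J)}"

definition TGWA ::
    "('n::finite \<Rightarrow> 'r::ring_1 \<Rightarrow> 'r) \<Rightarrow> ('n \<Rightarrow> 'r) \<Rightarrow> ('n, 'r) letter free_ring set set ring"
  where "TGWA h t = TGWC h t Quot TGW_radical h t"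

definition TGWA_class ::
    "('n::finite \<Rightarrow> 'r::ring_1 \<Rightarrow> 'r) \<Rightarrow> ('n \<Rightarrow> 'r) \<Rightarrow> ('n, 'r) letter free_ring set \<Rightarrow>
     ('n, 'r) letter free_ring set set"
  where "TGWA_class h t x = TGW_radical h t +>\<^bsub>TGWC h t\<^esub> x"

definition TGWA_component ::
    "('n::finite \<Rightarrow> 'r::ring_1 \<Rightarrow> 'r) \<Rightarrow> ('n \<Rightarrow> 'r) \<Rightarrow> int ^ 'n \<Rightarrow>
     ('n, 'r) letter free_ring set set set"
  where "TGWA_component h t d = TGWA_class h t ` TGWC_component h t d"

definition TGWA_of_coef ::
    "('n::finite \<Rightarrow> 'r::ring_1 \<Rightarrow> 'r) \<Rightarrow> ('n \<Rightarrow> 'r) \<Rightarrow> 'r \<Rightarrow> ('n, 'r) letter free_ring set set"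
  where "TGWA_of_coef h t r = TGWA_class h t (TGWC_class h t (gen (Coef r)))"

text \<open>
  For \<open>R\<close> a polynomial ring over \<open>'k\<close>, the \<open>'k\<close>-algebra structure of \<open>TGWA h t\<close> is given by
  the composite \<open>'k \<rightarrow> R \<rightarrow> TGWA h t\<close>.
\<close>

definition graded_algebra_isomorphic ::
    "('n::finite \<Rightarrow> ('m, 'k::field) mpoly \<Rightarrow> ('m, 'k) mpoly) \<Rightarrow> ('n \<Rightarrow> ('m, 'k) mpoly) \<Rightarrow>
     ('n \<Rightarrow> ('m, 'k) mpoly \<Rightarrow> ('m, 'k) mpoly) \<Rightarrow> ('n \<Rightarrow> ('m, 'k) mpoly) \<Rightarrow> bool"
  where "graded_algebra_isomorphic h t h' t' \<longleftrightarrow>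
    (\<exists>\<phi> \<in> ring_iso (TGWA h t) (TGWA h' t').
      (\<forall>c. \<phi> (TGWA_of_coef h t (Const c)) = TGWA_of_coef h' t' (Const c)) \<and>
      (\<forall>d. \<phi> ` TGWA_component h t d = TGWA_component h' t' d))"

end

theory Submission
  imports Defs
begin

text \<open>
  Let \<open>I\<close> be the ideal of relations in the free ring. An element of the free ring vanishes in the
  twisted generalized Weyl algebra iff \<open>v f\<^sub>d w \<in> I\<close> for each homogeneous part \<open>f\<^sub>d\<close> of \<open>f\<close> and all words
  \<open>v\<close>, \<open>w\<close> such that \<open>v f\<^sub>d w\<close> has degree zero; this depends only on \<open>I\<close> and the grading.

  An equivalence \<open>\<psi>\<close> of pairs with \<open>\<psi>(p\<^sub>i) = c\<^sub>i p'\<^sub>i\<close> therefore induces a graded isomorphism through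
  \<open>X\<^sub>i\<^sup>+ \<mapsto> c\<^sub>i X\<^sub>i\<^sup>+\<close> and \<open>X\<^sub>i\<^sup>- \<mapsto> X\<^sub>i\<^sup>-\<close>, once \<open>\<psi>\<close> is known to intertwine the half shifts and not only the
  shifts: the orbit of a polynomial under a translation is a polynomial function of the exponent,
  hence determined by the even exponents.

  Conversely, consistency makes \<open>R\<close> embed as the degree zero part, so a graded isomorphism restricts
  to an automorphism \<open>\<psi>\<close> of \<open>R\<close>. The component of degree \<open>\<plusminus>e\<^sub>i\<close> is \<open>R X\<^sub>i\<^sup>\<plusminus>\<close>, whence \<open>X\<^sub>i\<^sup>\<plusminus>\<close> is mapped to
  a unit of \<open>R\<close>, i.e. a nonzero scalar, times \<open>X\<^sub>i\<^sup>\<plusminus>\<close>. Comparing \<open>X\<^sub>i\<^sup>+ r\<close> and \<open>X\<^sub>i\<^sup>+ X\<^sub>i\<^sup>-\<close> yields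
  the two conditions on \<open>\<psi>\<close>.
\<close>

section \<open>Two-sided ideals, unital homomorphisms and monoid rings\<close>

lemma ring_ring_of_type_algebra: "ring (ring_of_type_algebra :: 'a::ring_1 ring)"
proof -
  have "\<exists>y. x + y = 0" for x :: 'a
    by (rule exI [of _ "- x"]) simp
  then have "\<exists>y. y + x = 0 \<and> x + y = 0" for x :: 'a
    by (metis add.commute)
  then show ?thesis
    unfolding ring_of_type_algebra_def
    by unfold_locales (auto simp: algebra_simps Units_def)
qed

lemma ring_of_type_algebra_simps [simp]:
  "carrier ring_of_type_algebra = UNIV"
  "\<one>\<^bsub>ring_of_type_algebra\<^esub> = 1"
  "\<zero>\<^bsub>ring_of_type_algebra\<^esub> = 0"
  "x \<oplus>\<^bsub>ring_of_type_algebra\<^esub> y = x + y"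
  "x \<otimes>\<^bsub>ring_of_type_algebra\<^esub> y = x * y"
  by (simp_all add: ring_of_type_algebra_def)

lemma ring_of_type_algebra_minus [simp]: "x \<ominus>\<^bsub>ring_of_type_algebra\<^esub> y = x - (y :: 'a::ring_1)"
proof -
  interpret ring "ring_of_type_algebra :: 'a ring"
    by (rule ring_ring_of_type_algebra)
  have "\<ominus>\<^bsub>ring_of_type_algebra\<^esub> y = - y"
    by (rule minus_equality) simp_all
  then show ?thesis
    by (simp add: a_minus_def)
qed

locale two_sided_ideal =
  fixes J :: "'a::ring_1 set"
  assumes zero_mem [simp]: "0 \<in> J"
    and add_mem: "x \<in> J \<Longrightarrow> y \<in> J \<Longrightarrow> x + y \<in> J"
    and lmult_mem: "x \<in> J \<Longrightarrow> a * x \<in> J"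
    and rmult_mem: "x \<in> J \<Longrightarrow> x * a \<in> J"
begin

lemma uminus_mem: "x \<in> J \<Longrightarrow> - x \<in> J"
  using lmult_mem [of x "-1"] by simp

lemma diff_mem: "x \<in> J \<Longrightarrow> y \<in> J \<Longrightarrow> x - y \<in> J"
  using add_mem [of x "- y"] uminus_mem [of y] by simp

lemma sum_mem: "(\<And>i. i \<in> A \<Longrightarrow> f i \<in> J) \<Longrightarrow> sum f A \<in> J"
  by (induction A rule: infinite_finite_induct) (auto intro: add_mem)

definition cong :: "'a \<Rightarrow> 'a \<Rightarrow> bool" (infix "\<approx>" 50)
  where "x \<approx> y \<longleftrightarrow> x - y \<in> J"

lemma cong_refl [simp]: "x \<approx> x"
  by (simp add: cong_def)

lemma cong_sym: "x \<approx> y \<Longrightarrow> y \<approx> x"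
  using uminus_mem [of "x - y"] by (simp add: cong_def)

lemma cong_trans [trans]: "x \<approx> y \<Longrightarrow> y \<approx> z \<Longrightarrow> x \<approx> z"
  using add_mem [of "x - y" "y - z"] by (simp add: cong_def)

lemma cong_add: "x \<approx> x' \<Longrightarrow> y \<approx> y' \<Longrightarrow> x + y \<approx> x' + y'"
  using add_mem [of "x - x'" "y - y'"] by (simp add: cong_def algebra_simps)

lemma cong_mult: "x \<approx> x' \<Longrightarrow> y \<approx> y' \<Longrightarrow> x * y \<approx> x' * y'"
  using add_mem [of "(x - x') * y" "x' * (y - y')"] lmult_mem [of "y - y'" x'] rmult_mem [of "x - x'" y]
  by (simp add: cong_def algebra_simps)

lemma cong_lmult: "x \<approx> y \<Longrightarrow> a * x \<approx> a * y"
  by (simp add: cong_mult)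

lemma cong_rmult: "x \<approx> y \<Longrightarrow> x * a \<approx> y * a"
  by (simp add: cong_mult)

lemma cong_mem: "x \<approx> y \<Longrightarrow> x \<in> J \<longleftrightarrow> y \<in> J"
  unfolding cong_def using diff_mem [of x "x - y"] add_mem [of "x - y" y] by auto

lemma ideal: "ideal J ring_of_type_algebra"
proof (intro idealI subgroup.intro)
  fix x assume "x \<in> J"
  then have "inv\<^bsub>add_monoid ring_of_type_algebra\<^esub> x = - x"
    by (intro group.inv_equality abelian_group.a_group ring.is_abelian_group ring_ring_of_type_algebra)
      simp_all
  then show "inv\<^bsub>add_monoid ring_of_type_algebra\<^esub> x \<in> J"
    using \<open>x \<in> J\<close> by (simp add: uminus_mem)
qed (auto intro: ring_ring_of_type_algebra add_mem lmult_mem rmult_mem)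

end

lemma two_sided_ideal_iff_ideal: "two_sided_ideal J \<longleftrightarrow> ideal J ring_of_type_algebra"
proof
  assume "ideal J ring_of_type_algebra"
  then interpret ideal J ring_of_type_algebra .
  show "two_sided_ideal J"
    using additive_subgroup.zero_closed [OF additive_subgroup_axioms]
      additive_subgroup.a_closed [OF additive_subgroup_axioms] I_l_closed I_r_closed
    by unfold_locales auto
qed (simp add: two_sided_ideal.ideal)

lemma two_sided_ideal_genideal: "two_sided_ideal (genideal ring_of_type_algebra S)"
  unfolding two_sided_ideal_iff_ideal
  by (intro ring.genideal_ideal ring_ring_of_type_algebra) simp

lemma genideal_subset: "two_sided_ideal J \<Longrightarrow> S \<subseteq> J \<Longrightarrow> genideal ring_of_type_algebra S \<subseteq> J"
  by (intro ring.genideal_minimal ring_ring_of_type_algebra) (simp_all add: two_sided_ideal_iff_ideal)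

lemma genideal_self: "S \<subseteq> genideal ring_of_type_algebra S"
  by (intro ring.genideal_self ring_ring_of_type_algebra) simp

locale unital_hom =
  fixes f :: "'a::ring_1 \<Rightarrow> 'b::ring_1"
  assumes one [simp]: "f 1 = 1"
    and add [simp]: "f (x + y) = f x + f y"
    and mult [simp]: "f (x * y) = f x * f y"
begin

lemma zero [simp]: "f 0 = 0"
  using add [of 0 0] by (simp del: add)

lemma uminus [simp]: "f (- x) = - f x"
  using add [of x "- x"] by (simp del: add add: eq_neg_iff_add_eq_0 add.commute)

lemma diff [simp]: "f (x - y) = f x - f y"
  using add [of x "- y"] by (simp del: add)

lemma sum: "f (sum g A) = (\<Sum>i\<in>A. f (g i))"
  by (induction A rule: infinite_finite_induct) simp_all

lemma power [simp]: "f (x ^ n) = f x ^ n"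
  by (induction n) simp_all

lemma of_nat [simp]: "f (of_nat n) = of_nat n"
  by (induction n) simp_all

lemma two_sided_ideal_vimage: "two_sided_ideal J \<Longrightarrow> two_sided_ideal (f -` J)"
  by (simp add: two_sided_ideal_def)

end

lemma unital_hom_comp: "unital_hom f \<Longrightarrow> unital_hom g \<Longrightarrow> unital_hom (\<lambda>x. g (f x))"
  by (simp add: unital_hom_def)

lemma unital_hom_prod:
  fixes f :: "'a::comm_ring_1 \<Rightarrow> 'b::comm_ring_1"
  assumes "unital_hom f"
  shows "f (prod g A) = (\<Prod>i\<in>A. f (g i))"
proof -
  interpret unital_hom f by fact
  show ?thesis
    by (induction A rule: infinite_finite_induct) simp_all
qed

lemma poly_mapping_sum_single: "f = (\<Sum>a\<in>Poly_Mapping.keys f. Poly_Mapping.single a (Poly_Mapping.lookup f a))"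
  by (rule poly_mapping_eqI)
    (auto simp: lookup_sum lookup_single when_def in_keys_iff sum.delta)

lemma poly_mapping_add_induct [case_names single add]:
  fixes f :: "'a \<Rightarrow>\<^sub>0 'b::comm_monoid_add"
  assumes "\<And>a c. P (Poly_Mapping.single a c)"
    and "\<And>f g. P f \<Longrightarrow> P g \<Longrightarrow> P (f + g)"
  shows "P f"
proof -
  have "P (\<Sum>a\<in>A. Poly_Mapping.single a (Poly_Mapping.lookup f a))" if "finite A" for A
    using that
  proof induction
    case empty
    show ?case using assms(1) [of undefined 0] by simp
  qed (simp add: assms)
  then show ?thesis
    using poly_mapping_sum_single [of f] by (metis finite_keys)
qed

definition linear_ext :: "('k::zero \<Rightarrow> 'r::ring_1) \<Rightarrow> ('a \<Rightarrow> 'r) \<Rightarrow> ('a \<Rightarrow>\<^sub>0 'k) \<Rightarrow> 'r"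
  where "linear_ext c \<phi> f = (\<Sum>a\<in>Poly_Mapping.keys f. c (Poly_Mapping.lookup f a) * \<phi> a)"

locale monoid_ring_hom = unital_hom c
  for c :: "'k::ring_1 \<Rightarrow> 'r::ring_1" +
  fixes \<phi> :: "'a::monoid_add \<Rightarrow> 'r"
  assumes phi_zero [simp]: "\<phi> 0 = 1"
    and phi_add: "\<phi> (a + b) = \<phi> a * \<phi> b"
    and commute: "c x * \<phi> a = \<phi> a * c x"
begin

lemma linear_ext_superset:
  "finite A \<Longrightarrow> Poly_Mapping.keys f \<subseteq> A \<Longrightarrow>
    linear_ext c \<phi> f = (\<Sum>a\<in>A. c (Poly_Mapping.lookup f a) * \<phi> a)"
  unfolding linear_ext_def by (rule sum.mono_neutral_left) (auto simp: in_keys_iff)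

lemma linear_ext_single [simp]: "linear_ext c \<phi> (Poly_Mapping.single a x) = c x * \<phi> a"
  by (simp add: linear_ext_def)

lemma linear_ext_add: "linear_ext c \<phi> (f + g) = linear_ext c \<phi> f + linear_ext c \<phi> g"
proof -
  let ?A = "Poly_Mapping.keys f \<union> Poly_Mapping.keys g"
  have "Poly_Mapping.keys (f + g) \<subseteq> ?A"
    by (rule keys_add)
  then show ?thesis
    by (simp add: linear_ext_superset [of ?A] lookup_add distrib_right sum.distrib)
qed

lemma linear_ext_mult: "linear_ext c \<phi> (f * g) = linear_ext c \<phi> f * linear_ext c \<phi> g"
proof (induction f rule: poly_mapping_add_induct)
  case (single a x)
  show ?case
  proof (induction g rule: poly_mapping_add_induct)
    case (single b y)
    show ?case
    proof -
      have "c x * c y * (\<phi> a * \<phi> b) = c x * (c y * \<phi> a) * \<phi> b"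
        by (simp only: mult.assoc)
      also have "\<dots> = c x * \<phi> a * (c y * \<phi> b)"
        by (simp only: commute [of y a] mult.assoc)
      finally show ?thesis
        by (simp only: mult_single phi_add linear_ext_single mult)
    qed
  qed (simp add: linear_ext_add distrib_left)
qed (simp add: linear_ext_add distrib_right)

sublocale linear_ext: unital_hom "linear_ext c \<phi>"
proof
  show "linear_ext c \<phi> 1 = 1"
    by (simp flip: single_one)
qed (simp_all add: linear_ext_add linear_ext_mult)

end

definition free_lift :: "('g \<Rightarrow> 'r::ring_1) \<Rightarrow> 'g free_ring \<Rightarrow> 'r"
  where "free_lift L = linear_ext of_int (\<lambda>w. prod_list (map L (letters w)))"

lemma letters_zero [simp]: "letters 0 = []"
  by (simp add: zero_word_def)

lemma letters_plus [simp]: "letters (v + w) = letters v @ letters w"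
  by (simp add: plus_word_def)

lemma monoid_ring_hom_free:
  "monoid_ring_hom (of_int :: int \<Rightarrow> 'r::ring_1) (\<lambda>w. prod_list (map L (letters w)))"
  by unfold_locales (simp_all, rule mult_of_int_commute)

lemma unital_hom_free_lift: "unital_hom (free_lift L :: _ \<Rightarrow> 'r::ring_1)"
proof -
  interpret monoid_ring_hom "of_int :: int \<Rightarrow> 'r" "\<lambda>w. prod_list (map L (letters w))"
    by (rule monoid_ring_hom_free)
  show ?thesis
    unfolding free_lift_def by (rule linear_ext.unital_hom_axioms)
qed

lemma free_lift_single:
  "free_lift L (Poly_Mapping.single w x) = (of_int x * prod_list (map L (letters w)) :: 'r::ring_1)"
proof -
  interpret monoid_ring_hom "of_int :: int \<Rightarrow> 'r" "\<lambda>w. prod_list (map L (letters w))"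
    by (rule monoid_ring_hom_free)
  show ?thesis
    by (simp add: free_lift_def)
qed

lemma free_lift_gen [simp]: "free_lift L (gen g) = L g"
  by (simp add: gen_def free_lift_single)

section \<open>The radical in terms of the free ring\<close>

lemma two_sided_idealI_single:
  fixes J :: "('a::monoid_add \<Rightarrow>\<^sub>0 'b::ring_1) set"
  assumes "0 \<in> J" and add: "\<And>f g. f \<in> J \<Longrightarrow> g \<in> J \<Longrightarrow> f + g \<in> J"
    and "\<And>f a c. f \<in> J \<Longrightarrow> Poly_Mapping.single a c * f \<in> J"
    and "\<And>f a c. f \<in> J \<Longrightarrow> f * Poly_Mapping.single a c \<in> J"
  shows "two_sided_ideal J"
proof
  fix f g assume "f \<in> J"
  then show "g * f \<in> J"
    by (induction g rule: poly_mapping_add_induct) (simp_all add: assms distrib_right)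
  show "f * g \<in> J"
    using \<open>f \<in> J\<close> by (induction g rule: poly_mapping_add_induct) (simp_all add: assms distrib_left)
qed (use assms in auto)

lemma word_degree_zero [simp]: "word_degree 0 = 0"
  by (simp add: word_degree_def)

lemma word_degree_plus [simp]: "word_degree (v + w) = word_degree v + word_degree w"
  by (simp add: word_degree_def)

lemma word_degree_Word [simp]:
  "word_degree (Word []) = 0" "word_degree (Word (x # xs)) = letter_degree x + word_degree (Word xs)"
  by (simp_all add: word_degree_def)

lemma letter_degree_opp [simp]:
  "letter_degree (Xgen (opp e) i :: ('n::finite, 'r) letter) = - letter_degree (Xgen e i :: ('n, 'r) letter)"
  by (cases e) simp_all

definition homogeneous :: "int ^ 'n \<Rightarrow> ('n, 'r) letter free_ring \<Rightarrow> bool"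
  where "homogeneous d f \<longleftrightarrow> (\<forall>w\<in>Poly_Mapping.keys f. word_degree w = d)"

definition homogeneous_part ::
    "int ^ 'n \<Rightarrow> ('n, 'r) letter free_ring \<Rightarrow> ('n, 'r) letter free_ring"
  where "homogeneous_part d = Poly_Mapping.mapp (\<lambda>w c. c when word_degree w = d)"

lemma lookup_homogeneous_part:
  "Poly_Mapping.lookup (homogeneous_part d f) w = (Poly_Mapping.lookup f w when word_degree w = d)"
  by (auto simp: homogeneous_part_def Poly_Mapping.lookup_mapp when_def in_keys_iff)

lemma homogeneous_part_zero [simp]: "homogeneous_part d 0 = 0"
  by (rule poly_mapping_eqI) (simp add: lookup_homogeneous_part)

lemma homogeneous_part_add [simp]:
  "homogeneous_part d (f + g) = homogeneous_part d f + homogeneous_part d g"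
  by (rule poly_mapping_eqI) (simp add: lookup_homogeneous_part lookup_add when_add_distrib)

lemma homogeneous_part_single:
  "homogeneous_part d (Poly_Mapping.single w c) = (if word_degree w = d then Poly_Mapping.single w c else 0)"
  by (rule poly_mapping_eqI) (simp add: lookup_homogeneous_part lookup_single when_def)

lemma homogeneous_part_single_mult:
  "homogeneous_part d (Poly_Mapping.single w c * f) =
    Poly_Mapping.single w c * homogeneous_part (d - word_degree w) f"
  by (induction f rule: poly_mapping_add_induct)
    (auto simp: mult_single homogeneous_part_single distrib_left algebra_simps)

lemma homogeneous_part_mult_single:
  "homogeneous_part d (f * Poly_Mapping.single w c) =
    homogeneous_part (d - word_degree w) f * Poly_Mapping.single w c"
  by (induction f rule: poly_mapping_add_induct)
    (auto simp: mult_single homogeneous_part_single distrib_right algebra_simps)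

lemma homogeneous_homogeneous_part [simp]: "homogeneous d (homogeneous_part d f)"
  by (auto simp: homogeneous_def in_keys_iff lookup_homogeneous_part when_def split: if_splits)

lemma homogeneous_part_homogeneous:
  assumes "homogeneous d f"
  shows "homogeneous_part e f = (if e = d then f else 0)"
proof (rule poly_mapping_eqI)
  fix w
  show "Poly_Mapping.lookup (homogeneous_part e f) w = Poly_Mapping.lookup (if e = d then f else 0) w"
    using assms by (cases "w \<in> Poly_Mapping.keys f")
      (auto simp: homogeneous_def lookup_homogeneous_part in_keys_iff when_def)
qed

lemma sum_homogeneous_part:
  "f = (\<Sum>d\<in>word_degree ` Poly_Mapping.keys f. homogeneous_part d f)"
proof (rule poly_mapping_eqI)
  fix w
  have "(\<Sum>d\<in>word_degree ` Poly_Mapping.keys f. Poly_Mapping.lookup f w when word_degree w = d) =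
      Poly_Mapping.lookup f w"
    by (cases "w \<in> Poly_Mapping.keys f") (auto simp: when_def in_keys_iff)
  then show "Poly_Mapping.lookup f w =
      Poly_Mapping.lookup (\<Sum>d\<in>word_degree ` Poly_Mapping.keys f. homogeneous_part d f) w"
    by (simp add: lookup_sum lookup_homogeneous_part)
qed

lemma homogeneous_zero [simp]: "homogeneous d 0"
  by (simp add: homogeneous_def)

lemma homogeneous_add: "homogeneous d f \<Longrightarrow> homogeneous d g \<Longrightarrow> homogeneous d (f + g)"
  unfolding homogeneous_def using keys_add [of f g] by auto

lemma homogeneous_diff: "homogeneous d f \<Longrightarrow> homogeneous d g \<Longrightarrow> homogeneous d (f - g)"
  unfolding homogeneous_def using keys_diff [of f g] by auto

lemma homogeneous_mult:
  assumes "homogeneous d f" and "homogeneous e g"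
  shows "homogeneous (d + e) (f * g)"
  unfolding homogeneous_def
proof
  fix w assume "w \<in> Poly_Mapping.keys (f * g)"
  then obtain u v where "w = u + v" "u \<in> Poly_Mapping.keys f" "v \<in> Poly_Mapping.keys g"
    using keys_mult [of f g] by blast
  then show "word_degree w = d + e"
    using assms by (simp add: homogeneous_def)
qed

lemma homogeneous_single: "word_degree w = d \<Longrightarrow> homogeneous d (Poly_Mapping.single w c)"
  by (auto simp: homogeneous_def)

lemma homogeneous_gen [simp]: "homogeneous (letter_degree x) (gen x)"
  by (simp add: gen_def homogeneous_single)

lemma homogeneous_gen_Coef [simp]: "homogeneous 0 (gen (Coef r))"
  using homogeneous_gen [of "Coef r"] by simp

lemma homogeneous_one [simp]: "homogeneous 0 1"
  using homogeneous_single [of 0 0 1] by simp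

lemma homogeneous_tgw_relation:
  assumes "f \<in> tgw_relations h t"
  shows "\<exists>d. homogeneous d f"
  using assms
proof cases
  case coef_one
  then show ?thesis by (auto intro!: homogeneous_diff exI [of _ 0])
next
  case coef_add
  then show ?thesis by (auto intro!: homogeneous_diff homogeneous_add exI [of _ 0])
next
  case (coef_mult r s)
  then show ?thesis
    using homogeneous_mult [of 0 "gen (Coef r)" 0 "gen (Coef s)"]
    by (auto intro!: homogeneous_diff exI [of _ 0])
next
  case (X_same e i)
  then show ?thesis
    using homogeneous_mult [OF homogeneous_gen [of "Xgen e i"] homogeneous_gen [of "Xgen (opp e) i"]]
    by (auto intro!: homogeneous_diff exI [of _ 0])
next
  case (X_distinct i j e)
  then show ?thesis
    using homogeneous_mult [OF homogeneous_gen [of "Xgen e i"] homogeneous_gen [of "Xgen (opp e) j"]]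
      homogeneous_mult [OF homogeneous_gen [of "Xgen (opp e) j"] homogeneous_gen [of "Xgen e i"]]
    by (auto simp: add.commute intro!: homogeneous_diff
        exI [of _ "letter_degree (Xgen e i) + letter_degree (Xgen (opp e) j)"])
next
  case (X_coef e i r)
  then show ?thesis
    using homogeneous_mult [OF homogeneous_gen [of "Xgen e i"] homogeneous_gen_Coef]
      homogeneous_mult [OF homogeneous_gen_Coef homogeneous_gen [of "Xgen e i"]]
    by (auto intro!: homogeneous_diff exI [of _ "letter_degree (Xgen e i)"])
qed

lemma two_sided_ideal_relation_ideal: "two_sided_ideal (tgw_relation_ideal h t)"
  unfolding tgw_relation_ideal_def by (rule two_sided_ideal_genideal)

lemma tgw_relations_subset: "tgw_relations h t \<subseteq> tgw_relation_ideal h t"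
  unfolding tgw_relation_ideal_def by (rule genideal_self)

lemma tgw_relation_ideal_least:
  "two_sided_ideal J \<Longrightarrow> tgw_relations h t \<subseteq> J \<Longrightarrow> tgw_relation_ideal h t \<subseteq> J"
  unfolding tgw_relation_ideal_def by (rule genideal_subset)

lemma homogeneous_part_relation_ideal:
  assumes "f \<in> tgw_relation_ideal h t"
  shows "homogeneous_part d f \<in> tgw_relation_ideal h t"
proof -
  interpret two_sided_ideal "tgw_relation_ideal h t"
    by (rule two_sided_ideal_relation_ideal)
  let ?J = "{f. \<forall>d. homogeneous_part d f \<in> tgw_relation_ideal h t}"
  have "two_sided_ideal ?J"
    by (rule two_sided_idealI_single)
      (simp_all add: add_mem lmult_mem rmult_mem homogeneous_part_single_mult homogeneous_part_mult_single)
  moreover have "tgw_relations h t \<subseteq> ?J"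
  proof
    fix g assume g: "g \<in> tgw_relations h t"
    then obtain e where "homogeneous e g"
      using homogeneous_tgw_relation by blast
    then show "g \<in> ?J"
      using g tgw_relations_subset by (auto simp: homogeneous_part_homogeneous)
  qed
  ultimately have "tgw_relation_ideal h t \<subseteq> ?J"
    by (rule tgw_relation_ideal_least)
  with assms show ?thesis by blast
qed

definition TGW_null ::
    "('n::finite \<Rightarrow> 'r::ring_1 \<Rightarrow> 'r) \<Rightarrow> ('n \<Rightarrow> 'r) \<Rightarrow> ('n, 'r) letter free_ring set"
  where "TGW_null h t = {f. \<forall>d v w. word_degree v + d + word_degree w = 0 \<longrightarrow>
    Poly_Mapping.single v 1 * homogeneous_part d f * Poly_Mapping.single w 1 \<in> tgw_relation_ideal h t}"

lemma two_sided_ideal_TGW_null: "two_sided_ideal (TGW_null h t)"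
proof -
  interpret two_sided_ideal "tgw_relation_ideal h t"
    by (rule two_sided_ideal_relation_ideal)
  show ?thesis
  proof (rule two_sided_idealI_single)
    fix f g assume "f \<in> TGW_null h t" "g \<in> TGW_null h t"
    then show "f + g \<in> TGW_null h t"
      by (simp add: TGW_null_def distrib_left distrib_right add_mem)
  next
    fix f a c assume f: "f \<in> TGW_null h t"
    show "Poly_Mapping.single a c * f \<in> TGW_null h t"
      unfolding TGW_null_def
    proof (intro CollectI allI impI)
      fix d and v w :: "('a, 'b) letter word"
      assume "word_degree v + d + word_degree w = (0 :: int ^ 'a)"
      then have "Poly_Mapping.single (v + a) 1 * homogeneous_part (d - word_degree a) f *
          Poly_Mapping.single w 1 \<in> tgw_relation_ideal h t" (is "?x \<in> _")
        using f by (simp add: TGW_null_def)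
      moreover have "Poly_Mapping.single v 1 * homogeneous_part d (Poly_Mapping.single a c * f) *
          Poly_Mapping.single w 1 = Poly_Mapping.single 0 c * ?x"
        by (simp add: homogeneous_part_single_mult mult_single flip: mult.assoc)
      ultimately show "Poly_Mapping.single v 1 * homogeneous_part d (Poly_Mapping.single a c * f) *
          Poly_Mapping.single w 1 \<in> tgw_relation_ideal h t"
        by (simp add: lmult_mem)
    qed
    show "f * Poly_Mapping.single a c \<in> TGW_null h t"
      unfolding TGW_null_def
    proof (intro CollectI allI impI)
      fix d and v w :: "('a, 'b) letter word"
      assume "word_degree v + d + word_degree w = (0 :: int ^ 'a)"
      then have "Poly_Mapping.single v 1 * homogeneous_part (d - word_degree a) f *
          Poly_Mapping.single (a + w) 1 \<in> tgw_relation_ideal h t" (is "?x \<in> _")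
        using f [unfolded TGW_null_def, THEN CollectD, rule_format, of v "d - word_degree a" "a + w"]
        by (simp add: algebra_simps)
      moreover have "Poly_Mapping.single v 1 * homogeneous_part d (f * Poly_Mapping.single a c) *
          Poly_Mapping.single w 1 = ?x * Poly_Mapping.single 0 c"
        by (simp add: homogeneous_part_mult_single mult_single mult.assoc)
      ultimately show "Poly_Mapping.single v 1 * homogeneous_part d (f * Poly_Mapping.single a c) *
          Poly_Mapping.single w 1 \<in> tgw_relation_ideal h t"
        by (simp add: rmult_mem)
    qed
  qed (simp add: TGW_null_def)
qed

lemma relation_ideal_subset_TGW_null: "tgw_relation_ideal h t \<subseteq> TGW_null h t"
proof -
  interpret two_sided_ideal "tgw_relation_ideal h t"
    by (rule two_sided_ideal_relation_ideal)
  show ?thesis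
    by (auto simp: TGW_null_def lmult_mem rmult_mem homogeneous_part_relation_ideal)
qed

lemma homogeneous_part_TGW_null:
  assumes "f \<in> TGW_null h t"
  shows "homogeneous_part d f \<in> TGW_null h t"
proof -
  interpret two_sided_ideal "tgw_relation_ideal h t"
    by (rule two_sided_ideal_relation_ideal)
  show ?thesis
    using assms
    by (auto simp: TGW_null_def homogeneous_part_homogeneous [OF homogeneous_homogeneous_part])
qed

lemma TGW_null_degree_zero:
  assumes "f \<in> TGW_null h t" and "homogeneous 0 f"
  shows "f \<in> tgw_relation_ideal h t"
proof -
  have "Poly_Mapping.single 0 1 * homogeneous_part 0 f * Poly_Mapping.single 0 1 \<in> tgw_relation_ideal h t"
    using assms(1) [unfolded TGW_null_def, THEN CollectD, rule_format, of 0 0 0] by simp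
  then show ?thesis
    using assms(2) by (simp add: homogeneous_part_homogeneous)
qed

lemma ideal_relation_ideal: "ideal (tgw_relation_ideal h t) ring_of_type_algebra"
  by (simp add: two_sided_ideal_relation_ideal flip: two_sided_ideal_iff_ideal)

lemma ring_TGWC: "ring (TGWC h t)"
  unfolding TGWC_def by (intro ideal.quotient_is_ring ideal_relation_ideal)

lemma TGWC_class_ring_hom: "TGWC_class h t \<in> ring_hom ring_of_type_algebra (TGWC h t)"
proof -
  have "TGWC_class h t = (+>\<^bsub>ring_of_type_algebra\<^esub>) (tgw_relation_ideal h t)"
    by (rule ext) (simp add: TGWC_class_def)
  then show ?thesis
    using ideal.rcos_ring_hom [OF ideal_relation_ideal] by (simp add: TGWC_def)
qed

lemma TGWC_class_simps:
  "TGWC_class h t 1 = \<one>\<^bsub>TGWC h t\<^esub>"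
  "TGWC_class h t (f + g) = TGWC_class h t f \<oplus>\<^bsub>TGWC h t\<^esub> TGWC_class h t g"
  "TGWC_class h t (f * g) = TGWC_class h t f \<otimes>\<^bsub>TGWC h t\<^esub> TGWC_class h t g"
  using TGWC_class_ring_hom [of h t] by (auto simp: ring_hom_def)

lemma carrier_TGWC: "carrier (TGWC h t) = range (TGWC_class h t)"
  by (auto simp: TGWC_def FactRing_def A_RCOSETS_def' TGWC_class_def)

lemma TGWC_class_carrier [simp]: "TGWC_class h t f \<in> carrier (TGWC h t)"
  by (simp add: carrier_TGWC)

lemma TGWC_class_eq_iff: "TGWC_class h t f = TGWC_class h t g \<longleftrightarrow> f - g \<in> tgw_relation_ideal h t"
  unfolding TGWC_class_def
  using ring.quotient_eq_iff_same_a_r_cos [OF ring_ring_of_type_algebra ideal_relation_ideal [of h t], of f g]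
  by simp

lemma TGWC_class_zero: "TGWC_class h t 0 = \<zero>\<^bsub>TGWC h t\<^esub>"
proof -
  interpret ring "TGWC h t" by (rule ring_TGWC)
  have "TGWC_class h t 0 \<oplus>\<^bsub>TGWC h t\<^esub> TGWC_class h t 0 = TGWC_class h t 0"
    by (simp flip: TGWC_class_simps)
  then show ?thesis
    by (metis TGWC_class_carrier add.r_cancel_one)
qed

lemma TGWC_class_eq_zero_iff:
  "TGWC_class h t f = \<zero>\<^bsub>TGWC h t\<^esub> \<longleftrightarrow> f \<in> tgw_relation_ideal h t"
  using TGWC_class_eq_iff [of h t f 0] by (simp add: TGWC_class_zero)

lemma TGWC_class_sum:
  "TGWC_class h t (sum g A) = finsum (TGWC h t) (\<lambda>i. TGWC_class h t (g i)) A"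
proof -
  interpret ring "TGWC h t" by (rule ring_TGWC)
  show ?thesis
    by (induction A rule: infinite_finite_induct)
      (simp_all add: TGWC_class_zero TGWC_class_simps finsum_insert)
qed

lemma TGWC_component_eq: "TGWC_component h t d = TGWC_class h t ` {f. homogeneous d f}"
  by (simp add: TGWC_component_def homogeneous_def)

lemma ideal_image_TGWC:
  assumes "two_sided_ideal J" and "tgw_relation_ideal h t \<subseteq> J"
  shows "ideal (TGWC_class h t ` J) (TGWC h t)"
proof -
  interpret two_sided_ideal J by fact
  interpret R: ring "TGWC h t" by (rule ring_TGWC)
  show ?thesis
  proof (intro idealI R.ring_axioms subgroup.intro)
    fix x assume "x \<in> TGWC_class h t ` J"
    then obtain f where f: "x = TGWC_class h t f" "f \<in> J" by blast
    have "TGWC_class h t (- f) \<oplus>\<^bsub>TGWC h t\<^esub> x = \<zero>\<^bsub>TGWC h t\<^esub>"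
      unfolding f by (simp add: TGWC_class_zero flip: TGWC_class_simps)
    then have "inv\<^bsub>add_monoid (TGWC h t)\<^esub> x = TGWC_class h t (- f)"
      using f(1) by (intro group.inv_equality abelian_group.a_group R.is_abelian_group) simp_all
    then show "inv\<^bsub>add_monoid (TGWC h t)\<^esub> x \<in> TGWC_class h t ` J"
      using f(2) by (simp add: uminus_mem)
  next
    show "\<one>\<^bsub>add_monoid (TGWC h t)\<^esub> \<in> TGWC_class h t ` J"
      using zero_mem by (force simp flip: TGWC_class_zero)
  next
    fix x y assume "x \<in> TGWC_class h t ` J" "y \<in> carrier (TGWC h t)"
    then obtain f g where "x = TGWC_class h t f" "f \<in> J" "y = TGWC_class h t g"
      by (auto simp: carrier_TGWC)
    then show "y \<otimes>\<^bsub>TGWC h t\<^esub> x \<in> TGWC_class h t ` J" "x \<otimes>\<^bsub>TGWC h t\<^esub> y \<in> TGWC_class h t ` J"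
      by (auto simp: lmult_mem rmult_mem simp flip: TGWC_class_simps)
  next
    fix x y assume "x \<in> TGWC_class h t ` J" "y \<in> TGWC_class h t ` J"
    then show "x \<otimes>\<^bsub>add_monoid (TGWC h t)\<^esub> y \<in> TGWC_class h t ` J"
      by (auto simp: add_mem simp flip: TGWC_class_simps)
  qed auto
qed

lemma TGW_radical_family_subset:
  assumes "J \<in> TGW_radical_family h t"
  shows "J \<subseteq> TGWC_class h t ` TGW_null h t"
proof
  from assms have graded: "graded_ideal h t J"
    and degree_zero: "J \<inter> TGWC_component h t 0 = {\<zero>\<^bsub>TGWC h t\<^esub>}"
    by (auto simp: TGW_radical_family_def)
  interpret ideal J "TGWC h t"
    using graded by (simp add: graded_ideal_def)
  interpret N: two_sided_ideal "TGW_null h t"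
    by (rule two_sided_ideal_TGW_null)
  fix x assume "x \<in> J"
  then obtain D y where D: "finite D" "\<And>d. d \<in> D \<Longrightarrow> y d \<in> J \<inter> TGWC_component h t d"
    and x: "x = finsum (TGWC h t) y D"
    using graded unfolding graded_ideal_def by metis
  have "\<forall>d\<in>D. \<exists>f. homogeneous d f \<and> y d = TGWC_class h t f"
    using D(2) by (auto simp: TGWC_component_eq)
  then obtain g where g: "\<And>d. d \<in> D \<Longrightarrow> homogeneous d (g d) \<and> y d = TGWC_class h t (g d)"
    by metis
  have "g d \<in> TGW_null h t" if "d \<in> D" for d
    unfolding TGW_null_def
  proof (intro CollectI allI impI)
    fix e and v w :: "('a, 'b) letter word"
    assume deg: "word_degree v + e + word_degree w = (0 :: int ^ 'a)"
    let ?v = "Poly_Mapping.single v 1" and ?w = "Poly_Mapping.single w 1"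
    show "?v * homogeneous_part e (g d) * ?w \<in> tgw_relation_ideal h t"
    proof (cases "e = d")
      case True
      have "TGWC_class h t (?v * g d * ?w) \<in> J"
        using D(2) [OF that] g [OF that] I_l_closed I_r_closed by (simp add: TGWC_class_simps)
      moreover have "homogeneous 0 (?v * g d * ?w)"
        using homogeneous_mult [OF homogeneous_mult [OF homogeneous_single [of v, OF refl] conjunct1 [OF g [OF that]]]
            homogeneous_single [of w, OF refl]] deg True by simp
      ultimately have "TGWC_class h t (?v * g d * ?w) \<in> J \<inter> TGWC_component h t 0"
        by (simp add: TGWC_component_eq)
      then have "TGWC_class h t (?v * g d * ?w) = \<zero>\<^bsub>TGWC h t\<^esub>"
        unfolding degree_zero by (rule singletonD)
      then show ?thesis
        using True by (simp add: TGWC_class_eq_zero_iff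
            homogeneous_part_homogeneous [OF conjunct1 [OF g [OF that]]])
    next
      case False
      then show ?thesis
        by (simp add: homogeneous_part_homogeneous [OF conjunct1 [OF g [OF that]]]
            two_sided_ideal.zero_mem [OF two_sided_ideal_relation_ideal])
    qed
  qed
  then have "sum g D \<in> TGW_null h t"
    by (rule N.sum_mem)
  moreover have "x = TGWC_class h t (sum g D)"
    unfolding x TGWC_class_sum using g by (intro finsum_cong') auto
  ultimately show "x \<in> TGWC_class h t ` TGW_null h t"
    by blast
qed

lemma TGW_null_in_radical_family: "TGWC_class h t ` TGW_null h t \<in> TGW_radical_family h t"
proof -
  have "\<exists>D y. finite D \<and> (\<forall>d\<in>D. y d \<in> TGWC_class h t ` TGW_null h t \<inter> TGWC_component h t d) \<and>
      TGWC_class h t f = finsum (TGWC h t) y D" if "f \<in> TGW_null h t" for f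
  proof (intro exI conjI ballI)
    show "TGWC_class h t f =
        (\<Oplus>\<^bsub>TGWC h t\<^esub>d\<in>word_degree ` Poly_Mapping.keys f. TGWC_class h t (homogeneous_part d f))"
      using sum_homogeneous_part [of f] by (simp flip: TGWC_class_sum)
  qed (auto simp: TGWC_component_eq homogeneous_part_TGW_null [OF that])
  moreover have "x = \<zero>\<^bsub>TGWC h t\<^esub>"
    if "x \<in> TGWC_class h t ` TGW_null h t" "x \<in> TGWC_component h t 0" for x
  proof -
    obtain f g where f: "x = TGWC_class h t f" "f \<in> TGW_null h t"
      and g: "x = TGWC_class h t g" "homogeneous 0 g"
      using \<open>x \<in> TGWC_class h t ` TGW_null h t\<close> \<open>x \<in> TGWC_component h t 0\<close>
      by (auto simp: TGWC_component_eq)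
    interpret two_sided_ideal "TGW_null h t"
      by (rule two_sided_ideal_TGW_null)
    have "g - f \<in> TGW_null h t"
      using f g relation_ideal_subset_TGW_null [of h t] by (auto simp: TGWC_class_eq_iff)
    then have "g \<in> TGW_null h t"
      using add_mem [of "g - f" f] f by simp
    then show ?thesis
      using g by (simp add: TGW_null_degree_zero TGWC_class_eq_zero_iff)
  qed
  moreover have "\<zero>\<^bsub>TGWC h t\<^esub> \<in> TGWC_class h t ` TGW_null h t" "\<zero>\<^bsub>TGWC h t\<^esub> \<in> TGWC_component h t 0"
    unfolding TGWC_component_eq
    by (auto intro!: image_eqI [where x = 0] TGWC_class_zero [symmetric]
        two_sided_ideal.zero_mem [OF two_sided_ideal_TGW_null])
  moreover have "ideal (TGWC_class h t ` TGW_null h t) (TGWC h t)"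
    by (intro ideal_image_TGWC two_sided_ideal_TGW_null relation_ideal_subset_TGW_null)
  ultimately show ?thesis
    unfolding TGW_radical_family_def graded_ideal_def by blast
qed

lemma TGW_radical_eq: "TGW_radical h t = TGWC_class h t ` TGW_null h t"
proof
  interpret ideal "TGWC_class h t ` TGW_null h t" "TGWC h t"
    using TGW_null_in_radical_family [of h t] by (simp add: TGW_radical_family_def graded_ideal_def)
  interpret N: two_sided_ideal "TGW_null h t"
    by (rule two_sided_ideal_TGW_null)
  show "TGW_radical h t \<subseteq> TGWC_class h t ` TGW_null h t"
  proof
    fix x assume "x \<in> TGW_radical h t"
    then obtain \<J> y where x: "x = finsum (TGWC h t) y \<J>" and J: "\<J> \<subseteq> TGW_radical_family h t" "\<forall>J\<in>\<J>. y J \<in> J"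
      by (auto simp: TGW_radical_def)
    then have "\<forall>J\<in>\<J>. \<exists>f\<in>TGW_null h t. y J = TGWC_class h t f"
      using TGW_radical_family_subset by blast
    then obtain g where g: "\<And>J. J \<in> \<J> \<Longrightarrow> g J \<in> TGW_null h t \<and> y J = TGWC_class h t (g J)"
      by metis
    have "x = TGWC_class h t (sum g \<J>)"
      unfolding x TGWC_class_sum using g by (intro finsum_cong') auto
    with g show "x \<in> TGWC_class h t ` TGW_null h t"
      by (auto intro: N.sum_mem)
  qed
  show "TGWC_class h t ` TGW_null h t \<subseteq> TGW_radical h t"
  proof
    fix x assume x: "x \<in> TGWC_class h t ` TGW_null h t"
    then have "x = finsum (TGWC h t) (\<lambda>_. x) {TGWC_class h t ` TGW_null h t}"
      by (auto simp: finsum_insert)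
    then show "x \<in> TGW_radical h t"
      unfolding TGW_radical_def using x TGW_null_in_radical_family by blast
  qed
qed

definition TGWA_map ::
    "('n::finite \<Rightarrow> 'r::ring_1 \<Rightarrow> 'r) \<Rightarrow> ('n \<Rightarrow> 'r) \<Rightarrow> ('n, 'r) letter free_ring \<Rightarrow>
     ('n, 'r) letter free_ring set set"
  where "TGWA_map h t f = TGWA_class h t (TGWC_class h t f)"

lemma ideal_TGW_radical: "ideal (TGW_radical h t) (TGWC h t)"
  unfolding TGW_radical_eq
  by (intro ideal_image_TGWC two_sided_ideal_TGW_null relation_ideal_subset_TGW_null)

lemma TGWA_map_simps:
  "TGWA_map h t 1 = \<one>\<^bsub>TGWA h t\<^esub>"
  "TGWA_map h t (f + g) = TGWA_map h t f \<oplus>\<^bsub>TGWA h t\<^esub> TGWA_map h t g"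
  "TGWA_map h t (f * g) = TGWA_map h t f \<otimes>\<^bsub>TGWA h t\<^esub> TGWA_map h t g"
  using ideal.rcos_ring_hom [OF ideal_TGW_radical [of h t]]
  by (auto simp: ring_hom_def TGWA_map_def TGWA_class_def TGWA_def TGWC_class_simps)

lemma carrier_TGWA: "carrier (TGWA h t) = range (TGWA_map h t)"
  by (auto simp: TGWA_def FactRing_def A_RCOSETS_def' TGWA_map_def TGWA_class_def carrier_TGWC)

lemma TGWA_map_carrier [simp]: "TGWA_map h t f \<in> carrier (TGWA h t)"
  by (simp add: carrier_TGWA)

lemma TGWA_map_eq_iff: "TGWA_map h t f = TGWA_map h t g \<longleftrightarrow> f - g \<in> TGW_null h t"
proof -
  interpret R: ring "TGWC h t" by (rule ring_TGWC)
  interpret N: two_sided_ideal "TGW_null h t"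
    by (rule two_sided_ideal_TGW_null)
  have "TGWC_class h t f = TGWC_class h t (f - g) \<oplus>\<^bsub>TGWC h t\<^esub> TGWC_class h t g"
    by (simp flip: TGWC_class_simps)
  then have "TGWC_class h t f \<ominus>\<^bsub>TGWC h t\<^esub> TGWC_class h t g = TGWC_class h t (f - g)"
    by (simp add: a_minus_def R.a_assoc R.r_neg)
  moreover have "TGWC_class h t (f - g) \<in> TGWC_class h t ` TGW_null h t \<longleftrightarrow> f - g \<in> TGW_null h t"
  proof
    assume "TGWC_class h t (f - g) \<in> TGWC_class h t ` TGW_null h t"
    then obtain k where "k \<in> TGW_null h t" "(f - g) - k \<in> TGW_null h t"
      using relation_ideal_subset_TGW_null [of h t] by (auto simp: TGWC_class_eq_iff)
    then show "f - g \<in> TGW_null h t"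
      using N.add_mem [of "f - g - k" k] by simp
  qed blast
  moreover have "TGWA_map h t f = TGWA_map h t g \<longleftrightarrow>
      TGWC_class h t f \<ominus>\<^bsub>TGWC h t\<^esub> TGWC_class h t g \<in> TGW_radical h t"
    unfolding TGWA_map_def TGWA_class_def
    by (rule ring.quotient_eq_iff_same_a_r_cos [OF ring_TGWC ideal_TGW_radical, symmetric]) simp_all
  ultimately show ?thesis
    by (simp add: TGW_radical_eq)
qed

lemma TGWA_component_eq: "TGWA_component h t d = TGWA_map h t ` {f. homogeneous d f}"
  by (auto simp: TGWA_component_def TGWC_component_eq TGWA_map_def)

lemma TGWA_of_coef_eq: "TGWA_of_coef h t r = TGWA_map h t (gen (Coef r))"
  by (simp add: TGWA_of_coef_def TGWA_map_def)

section \<open>Polynomials and translations\<close>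

lemma unital_hom_Const: "unital_hom (Const :: 'k::ring_1 \<Rightarrow> ('m, 'k) mpoly)"
  by unfold_locales (simp_all add: Const_def single_add mult_single)

lemma Const_zero [simp]: "Const 0 = 0"
  by (simp add: Const_def)

lemma Const_eq_iff [simp]: "Const x = Const y \<longleftrightarrow> x = y"
  by (auto simp: Const_def dest: arg_cong [where f = "\<lambda>p. Poly_Mapping.lookup p 0"])

definition eval_monom :: "('m::finite \<Rightarrow> 'r::comm_ring_1) \<Rightarrow> ('m \<Rightarrow>\<^sub>0 nat) \<Rightarrow> 'r"
  where "eval_monom s a = (\<Prod>j\<in>UNIV. s j ^ Poly_Mapping.lookup a j)"

lemma monoid_ring_hom_eval_monom:
  fixes c :: "'k::ring_1 \<Rightarrow> 'r::comm_ring_1"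
  assumes "unital_hom c"
  shows "monoid_ring_hom c (eval_monom s)"
proof -
  interpret unital_hom c by fact
  show ?thesis
    by unfold_locales (simp_all add: eval_monom_def lookup_add power_add prod.distrib mult.commute)
qed

lemma translation_eq_linear_ext: "translation v = linear_ext Const (eval_monom (\<lambda>j. Var j - Const (v j)))"
  by (simp add: fun_eq_iff translation_def linear_ext_def eval_monom_def)

lemma unital_hom_translation: "unital_hom (translation v)"
proof -
  interpret monoid_ring_hom Const "eval_monom (\<lambda>j. Var j - Const (v j))"
    by (intro monoid_ring_hom_eval_monom unital_hom_Const)
  show ?thesis
    unfolding translation_eq_linear_ext by (rule linear_ext.unital_hom_axioms)
qed

lemma Var_power: "Var j ^ n = (Poly_Mapping.single (Poly_Mapping.single j n) 1 :: ('m, 'k::comm_ring_1) mpoly)"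
  by (induction n) (simp_all add: Var_def mult_single flip: single_add)

lemma prod_single:
  "(\<Prod>j\<in>A. Poly_Mapping.single (f j) (1::'k::comm_ring_1)) =
    Poly_Mapping.single (\<Sum>j\<in>A. f j :: 'a::comm_monoid_add) 1"
  by (induction A rule: infinite_finite_induct) (simp_all add: mult_single)

lemma single_eq_Const_mult_monom:
  "Poly_Mapping.single a c = Const c * eval_monom Var (a :: 'm::finite \<Rightarrow>\<^sub>0 nat)"
proof -
  have "a = (\<Sum>j\<in>UNIV. Poly_Mapping.single j (Poly_Mapping.lookup a j))"
    by (rule poly_mapping_eqI) (simp add: lookup_sum lookup_single when_def)
  then have "eval_monom Var a = (Poly_Mapping.single a 1 :: ('m, 'a) mpoly)"
    by (simp add: eval_monom_def Var_power prod_single)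
  then show ?thesis
    by (simp add: Const_def mult_single)
qed

lemma unital_hom_eval_monom:
  assumes "unital_hom f"
  shows "f (eval_monom s a) = eval_monom (\<lambda>j. f (s j)) a"
proof -
  interpret unital_hom f by fact
  show ?thesis
    by (simp add: eval_monom_def unital_hom_prod [OF assms])
qed

lemma mpoly_hom_expand:
  fixes f :: "('m::finite, 'k::comm_ring_1) mpoly \<Rightarrow> 'r::comm_ring_1"
  assumes "unital_hom f"
  shows "f p = (\<Sum>a\<in>Poly_Mapping.keys p.
    f (Const (Poly_Mapping.lookup p a)) * eval_monom (\<lambda>j. f (Var j)) a)"
proof -
  interpret unital_hom f by fact
  have "f p = f (\<Sum>a\<in>Poly_Mapping.keys p. Poly_Mapping.single a (Poly_Mapping.lookup p a))"
    by (simp flip: poly_mapping_sum_single)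
  also have "\<dots> = (\<Sum>a\<in>Poly_Mapping.keys p. f (Poly_Mapping.single a (Poly_Mapping.lookup p a)))"
    by (rule sum)
  finally show ?thesis
    by (simp add: single_eq_Const_mult_monom unital_hom_eval_monom [OF assms])
qed

lemma mpoly_hom_eqI:
  fixes f g :: "('m::finite, 'k::comm_ring_1) mpoly \<Rightarrow> 'r::comm_ring_1"
  assumes "unital_hom f" and "unital_hom g"
    and "\<And>c. f (Const c) = g (Const c)" and "\<And>j. f (Var j) = g (Var j)"
  shows "f p = g p"
  by (simp only: mpoly_hom_expand [OF assms(1), of p] mpoly_hom_expand [OF assms(2), of p] assms(3,4))

lemma translation_translation: "translation v (translation w p) = translation (\<lambda>j. v j + w j) p"
proof (rule mpoly_hom_eqI [where f = "\<lambda>p. translation v (translation w p)" and p = p])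
  interpret t: unital_hom "translation v" by (rule unital_hom_translation)
  interpret C: unital_hom "Const :: 'b \<Rightarrow> ('a, 'b) mpoly" by (rule unital_hom_Const)
  show "unital_hom (\<lambda>p. translation v (translation w p))"
    by (rule unital_hom_comp [OF unital_hom_translation unital_hom_translation])
  show "translation v (translation w (Var j)) = translation (\<lambda>j. v j + w j) (Var j)" for j
    by (simp add: translation_Var translation_Const)
qed (simp_all add: unital_hom_translation translation_Const)

lemma translation_zero [simp]: "translation (\<lambda>j. 0) p = p"
proof (rule mpoly_hom_eqI [where g = "\<lambda>p. p" and p = p])
  show "translation (\<lambda>j. 0) (Var j) = Var j" for j
    by (simp add: translation_Var)
  show "unital_hom (translation (\<lambda>j. 0 :: 'b) :: ('a, 'b) mpoly \<Rightarrow> _)"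
    by (rule unital_hom_translation)
qed (simp_all add: translation_Const unital_hom_def)

lemma bij_translation: "bij (translation v)"
  by (rule o_bij [where g = "translation (\<lambda>j. - v j)"])
    (auto simp: translation_translation)

lemma inv_translation: "inv_into UNIV (translation v) = translation (\<lambda>j. - v j)"
  by (rule inv_unique_comp) (auto simp: translation_translation)

lemma half_half_shift:
  "half (half_shift \<alpha>) Pos i = translation (\<lambda>j. \<alpha> $ j $ i / 2)"
  "half (half_shift \<alpha>) Neg i = translation (\<lambda>j. - (\<alpha> $ j $ i / 2))"
  by (simp_all add: half_shift_def inv_translation)

text \<open>
  The \<open>idom\<close> instance for \<open>\<Rightarrow>\<^sub>0\<close> asks for linearly ordered variables, hence the renaming along \<open>to_nat\<close>.
\<close>

lemma embedding_into_field:
  obtains \<iota> :: "('m::finite, 'k::field) mpoly \<Rightarrow> ((nat \<Rightarrow>\<^sub>0 nat) \<Rightarrow>\<^sub>0 'k) fract"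
  where "unital_hom \<iota>" and "inj \<iota>"
proof -
  define \<phi> :: "('m \<Rightarrow>\<^sub>0 nat) \<Rightarrow> (nat \<Rightarrow>\<^sub>0 nat)"
    where "\<phi> a = (\<Sum>j\<in>UNIV. Poly_Mapping.single (to_nat j) (Poly_Mapping.lookup a j))" for a
  have lookup_phi: "Poly_Mapping.lookup (\<phi> a) (to_nat j) = Poly_Mapping.lookup a j" for a j
    by (simp add: \<phi>_def lookup_sum lookup_single when_def)
  have inj_phi: "\<phi> a = \<phi> b \<longleftrightarrow> a = b" for a b
    by (metis lookup_phi poly_mapping_eqI)
  define e :: "('m, 'k) mpoly \<Rightarrow> (nat \<Rightarrow>\<^sub>0 nat) \<Rightarrow>\<^sub>0 'k"
    where "e = linear_ext (Poly_Mapping.single 0) (\<lambda>a. Poly_Mapping.single (\<phi> a) 1)"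
  interpret monoid_ring_hom "Poly_Mapping.single 0 :: 'k \<Rightarrow> (nat \<Rightarrow>\<^sub>0 nat) \<Rightarrow>\<^sub>0 'k"
      "\<lambda>a. Poly_Mapping.single (\<phi> a) 1"
    by unfold_locales
      (simp_all add: single_add mult_single \<phi>_def lookup_add sum.distrib)
  interpret e: unital_hom e
    unfolding e_def by (rule linear_ext.unital_hom_axioms)
  have "Poly_Mapping.lookup (e p) (\<phi> a) = Poly_Mapping.lookup p a" for p a
    by (auto simp: e_def linear_ext_def mult_single lookup_sum lookup_single inj_phi when_def in_keys_iff)
  then have "inj e"
    by (metis injI poly_mapping_eqI)
  show thesis
  proof
    show "unital_hom (\<lambda>p. to_fract (e p))"
      by unfold_locales simp_all
    show "inj (\<lambda>p. to_fract (e p))"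
      using \<open>inj e\<close> by (auto simp: inj_def)
  qed
qed

lemma mpoly_mult_eq_0_iff:
  fixes p q :: "('m::finite, 'k::field) mpoly"
  shows "p * q = 0 \<longleftrightarrow> p = 0 \<or> q = 0"
proof
  obtain \<iota> :: "('m, 'k) mpoly \<Rightarrow> ((nat \<Rightarrow>\<^sub>0 nat) \<Rightarrow>\<^sub>0 'k) fract"
    where "unital_hom \<iota>" and "inj \<iota>"
    using embedding_into_field by blast
  interpret unital_hom \<iota> by fact
  assume "p * q = 0"
  then have "\<iota> p * \<iota> q = 0"
    using mult [of p q] by simp
  then have "\<iota> p = \<iota> 0 \<or> \<iota> q = \<iota> 0"
    by simp
  with \<open>inj \<iota>\<close> show "p = 0 \<or> q = 0"
    by (auto dest: injD simp del: zero)
qed auto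

lemma finite_linear_order_max:
  assumes "linear_order r" "finite A" "A \<noteq> {}"
  shows "\<exists>a\<in>A. \<forall>b\<in>A. (b, a) \<in> r"
  using assms(2,3)
proof (induction rule: finite_ne_induct)
  case (singleton x)
  then show ?case
    using assms(1) by (auto simp: order_on_defs refl_on_def)
next
  case (insert x F)
  then obtain a where a: "a \<in> F" "\<And>b. b \<in> F \<Longrightarrow> (b, a) \<in> r"
    by blast
  have refl: "(x, x) \<in> r" and trans: "trans r" and "x \<noteq> a \<Longrightarrow> (x, a) \<in> r \<or> (a, x) \<in> r"
    using assms(1) by (auto simp: order_on_defs refl_on_def total_on_def)
  then consider "(x, a) \<in> r" | "(a, x) \<in> r"
    by blast
  then show ?case
  proof cases
    case 1
    with a show ?thesis by blast
  next
    case 2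
    with a trans have "(b, x) \<in> r" if "b \<in> F" for b
      using that by (meson transD)
    with refl show ?thesis by blast
  qed
qed

lemma lookup_mult_unique:
  fixes p q :: "'a::monoid_add \<Rightarrow>\<^sub>0 'b::semiring_1"
  assumes "a \<in> Poly_Mapping.keys p" and "b \<in> Poly_Mapping.keys q"
    and unique: "\<And>u v. u \<in> Poly_Mapping.keys p \<Longrightarrow> v \<in> Poly_Mapping.keys q \<Longrightarrow> u + v = a + b \<Longrightarrow> u = a \<and> v = b"
  shows "Poly_Mapping.lookup (p * q) (a + b) = Poly_Mapping.lookup p a * Poly_Mapping.lookup q b"
proof -
  have "p * q = (\<Sum>u\<in>Poly_Mapping.keys p. \<Sum>v\<in>Poly_Mapping.keys q.
      Poly_Mapping.single (u + v) (Poly_Mapping.lookup p u * Poly_Mapping.lookup q v))"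
    by (subst poly_mapping_sum_single [of p], subst poly_mapping_sum_single [of q])
      (simp add: sum_product mult_single)
  then have "Poly_Mapping.lookup (p * q) (a + b) = (\<Sum>u\<in>Poly_Mapping.keys p. \<Sum>v\<in>Poly_Mapping.keys q.
      (Poly_Mapping.lookup p u * Poly_Mapping.lookup q v when u + v = a + b))"
    by (simp add: lookup_sum lookup_single)
  also have "\<dots> = (\<Sum>u\<in>Poly_Mapping.keys p. \<Sum>v\<in>Poly_Mapping.keys q.
      if u = a then if v = b then Poly_Mapping.lookup p u * Poly_Mapping.lookup q v else 0 else 0)"
    using unique by (intro sum.cong refl) (auto simp: when_def)
  also have "\<dots> = (\<Sum>u\<in>Poly_Mapping.keys p. if u = a then (\<Sum>v\<in>Poly_Mapping.keys q.
      if v = b then Poly_Mapping.lookup p u * Poly_Mapping.lookup q v else 0) else 0)"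
    by (intro sum.cong refl) simp
  finally show ?thesis
    using assms(1,2) by simp
qed

lemma mpoly_unit_extreme_key:
  fixes p q :: "('m::finite, 'k::field) mpoly"
  assumes "linear_order r" and compat: "\<And>a b c. (a, b) \<in> r \<Longrightarrow> (a + c, b + c) \<in> r" and "p * q = 1"
    and "u \<in> Poly_Mapping.keys p"
  shows "(u, 0) \<in> r"
proof -
  have "Poly_Mapping.keys p \<noteq> {}" "Poly_Mapping.keys q \<noteq> {}"
    using \<open>p * q = 1\<close> by auto
  then obtain a b where a: "a \<in> Poly_Mapping.keys p" "\<And>x. x \<in> Poly_Mapping.keys p \<Longrightarrow> (x, a) \<in> r"
    and b: "b \<in> Poly_Mapping.keys q" "\<And>x. x \<in> Poly_Mapping.keys q \<Longrightarrow> (x, b) \<in> r"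
    using finite_linear_order_max [OF \<open>linear_order r\<close>] finite_keys by metis
  have "Poly_Mapping.lookup (p * q) (a + b) = Poly_Mapping.lookup p a * Poly_Mapping.lookup q b"
  proof (rule lookup_mult_unique)
    fix x y assume "x \<in> Poly_Mapping.keys p" "y \<in> Poly_Mapping.keys q" "x + y = a + b"
    then have "(a + b, a + y) \<in> r" "(a + y, a + b) \<in> r"
      using compat [OF a(2), of x y] compat [OF b(2), of y a] by (simp_all add: add.commute)
    then have "a + y = a + b"
      using \<open>linear_order r\<close> unfolding order_on_defs antisym_def by blast
    with \<open>x + y = a + b\<close> show "x = a \<and> y = b"
      by simp
  qed (use a b in auto)
  then have "Poly_Mapping.lookup (1 :: ('m, 'k) mpoly) (a + b) \<noteq> 0"
    using a b \<open>p * q = 1\<close> by (simp add: in_keys_iff)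
  then have "a + b = 0"
    by (simp add: lookup_one when_def split: if_splits)
  then have "Poly_Mapping.lookup a j + Poly_Mapping.lookup b j = 0" for j
    by (metis lookup_add lookup_zero)
  then have "a = 0"
    by (intro poly_mapping_eqI) simp
  with a(2) [OF \<open>u \<in> Poly_Mapping.keys p\<close>] show ?thesis by simp
qed

lemma mpoly_unit_imp_Const:
  fixes p q :: "('m::finite, 'k::field) mpoly" and ord :: "('m \<Rightarrow>\<^sub>0 nat) rel"
  assumes "monomial_order ord" and "p * q = 1"
  obtains c where "c \<noteq> 0" and "p = Const c"
proof -
  have lin: "linear_order ord" and compat: "\<And>a b c. (a, b) \<in> ord \<Longrightarrow> (a + c, b + c) \<in> ord"
    using assms(1) by (auto simp: monomial_order_def well_order_on_def)
  have "u = 0" if "u \<in> Poly_Mapping.keys p" for u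
  proof -
    have "(u, 0) \<in> ord"
      by (rule mpoly_unit_extreme_key [OF lin compat assms(2) that])
    moreover have "(u, 0) \<in> ord\<inverse>"
      by (rule mpoly_unit_extreme_key [OF _ _ assms(2) that]) (use lin compat in auto)
    ultimately have "(u, 0) \<in> ord" "(0, u) \<in> ord"
      by auto
    then show ?thesis
      using lin by (auto simp: order_on_defs antisym_def)
  qed
  then have "p = Const (Poly_Mapping.lookup p 0)"
    unfolding Const_def
    by (intro poly_mapping_eqI) (auto simp: lookup_single when_def in_keys_iff)
  moreover have "p \<noteq> 0"
    using assms(2) by auto
  ultimately show thesis
    using that by (metis Const_def single_zero)
qed

lemma translation_orbit_polynomial:
  fixes \<kappa> :: "('m::finite, 'k::comm_ring_1) mpoly \<Rightarrow> 'r::comm_ring_1"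
  assumes "unital_hom \<kappa>"
  obtains P where "\<And>n. \<kappa> (translation (\<lambda>j. of_nat n * v j) f) = poly P (of_nat n)"
proof
  interpret unital_hom \<kappa> by fact
  interpret C: unital_hom "Const :: 'k \<Rightarrow> ('m, 'k) mpoly" by (rule unital_hom_Const)
  fix n
  interpret t: unital_hom "translation (\<lambda>j. of_nat n * v j)" by (rule unital_hom_translation)
  have "unital_hom (\<lambda>p. \<kappa> (translation (\<lambda>j. of_nat n * v j) p))"
    by (rule unital_hom_comp [OF unital_hom_translation assms])
  then show "\<kappa> (translation (\<lambda>j. of_nat n * v j) f) = poly (\<Sum>a\<in>Poly_Mapping.keys f.
      [:\<kappa> (Const (Poly_Mapping.lookup f a)):] *
        (\<Prod>j\<in>UNIV. [:\<kappa> (Var j), - \<kappa> (Const (v j)):] ^ Poly_Mapping.lookup a j)) (of_nat n)"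
    by (subst mpoly_hom_expand)
      (simp_all add: poly_sum poly_prod translation_Const translation_Var eval_monom_def)
qed

lemma intertwine_half:
  fixes v w :: "'m::finite \<Rightarrow> 'k::field_char_0"
  assumes "unital_hom \<psi>"
    and intertwine: "\<And>f. \<psi> (translation (\<lambda>j. 2 * v j) f) = translation (\<lambda>j. 2 * w j) (\<psi> f)"
  shows "\<psi> (translation v f) = translation w (\<psi> f)"
proof -
  obtain \<iota> :: "('m, 'k) mpoly \<Rightarrow> ((nat \<Rightarrow>\<^sub>0 nat) \<Rightarrow>\<^sub>0 'k) fract"
    where "unital_hom \<iota>" and "inj \<iota>"
    using embedding_into_field by blast
  interpret \<iota>: unital_hom \<iota> by fact
  interpret C: unital_hom "Const :: 'k \<Rightarrow> ('m, 'k) mpoly" by (rule unital_hom_Const)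
  obtain P where P: "\<And>n. \<iota> (\<psi> (translation (\<lambda>j. of_nat n * v j) f)) = poly P (of_nat n)"
    using translation_orbit_polynomial [OF unital_hom_comp [OF assms(1) \<open>unital_hom \<iota>\<close>]] by blast
  obtain Q where Q: "\<And>n. \<iota> (translation (\<lambda>j. of_nat n * w j) (\<psi> f)) = poly Q (of_nat n)"
    using translation_orbit_polynomial [OF \<open>unital_hom \<iota>\<close>] by blast
  have even: "\<psi> (translation (\<lambda>j. of_nat (2 * n) * v j) f) = translation (\<lambda>j. of_nat (2 * n) * w j) (\<psi> f)" for n
  proof (induction n)
    case (Suc n)
    have split: "of_nat (2 * Suc n) * x = 2 * x + of_nat (2 * n) * x" for x :: 'k
      by (simp add: algebra_simps)
    show ?case
      unfolding split translation_translation [symmetric] intertwine Suc ..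
  qed simp
  have "inj (of_nat :: nat \<Rightarrow> ((nat \<Rightarrow>\<^sub>0 nat) \<Rightarrow>\<^sub>0 'k) fract)"
  proof (rule injI)
    fix m n assume "(of_nat m :: ((nat \<Rightarrow>\<^sub>0 nat) \<Rightarrow>\<^sub>0 'k) fract) = of_nat n"
    then have "\<iota> (Const (of_nat m)) = \<iota> (Const (of_nat n))"
      by simp
    then show "m = n"
      using \<open>inj \<iota>\<close> by (metis Const_eq_iff injD of_nat_eq_iff)
  qed
  then have "inj (\<lambda>n. of_nat (2 * n) :: ((nat \<Rightarrow>\<^sub>0 nat) \<Rightarrow>\<^sub>0 'k) fract)"
    by (intro injI) (simp del: of_nat_mult add: inj_eq)
  then have "infinite (range (\<lambda>n. of_nat (2 * n) :: ((nat \<Rightarrow>\<^sub>0 nat) \<Rightarrow>\<^sub>0 'k) fract))"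
    using finite_imageD infinite_UNIV_nat by blast
  moreover have "range (\<lambda>n. of_nat (2 * n)) \<subseteq> {x. poly (P - Q) x = 0}"
    using P Q even by (auto simp del: of_nat_mult)
      (metis)
  ultimately have "P - Q = 0"
    using poly_roots_finite finite_subset by blast
  then have "\<iota> (\<psi> (translation v f)) = \<iota> (translation w (\<psi> f))"
    using P [of 1] Q [of 1] by simp
  then show ?thesis
    using \<open>inj \<iota>\<close> by (auto dest: injD)
qed

section \<open>A faithful representation of the degree zero part\<close>

text \<open>
  Additive endomorphisms of a function space rather than of an arbitrary abelian group: they
  satisfy \<open>0 \<noteq> 1\<close>, as the class \<open>ring_1\<close> demands.
\<close>

typedef (overloaded) ('i, 'a) fun_endo =
    "{F :: ('i \<Rightarrow> 'a::ring_1) \<Rightarrow> 'i \<Rightarrow> 'a. \<forall>x y. F (\<lambda>i. x i + y i) = (\<lambda>i. F x i + F y i)}"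
  morphisms apply_endo Endo
  by (rule exI [of _ id]) simp

setup_lifting type_definition_fun_endo

instantiation fun_endo :: (type, ring_1) ring_1
begin

lift_definition zero_fun_endo :: "('a, 'b) fun_endo" is "\<lambda>x i. 0" by simp

lift_definition one_fun_endo :: "('a, 'b) fun_endo" is "\<lambda>x. x" by simp

lift_definition plus_fun_endo :: "('a, 'b) fun_endo \<Rightarrow> ('a, 'b) fun_endo \<Rightarrow> ('a, 'b) fun_endo"
  is "\<lambda>F G x i. F x i + G x i" by (simp add: fun_eq_iff algebra_simps)

lift_definition uminus_fun_endo :: "('a, 'b) fun_endo \<Rightarrow> ('a, 'b) fun_endo"
  is "\<lambda>F x i. - F x i" by (simp add: fun_eq_iff)

lift_definition minus_fun_endo :: "('a, 'b) fun_endo \<Rightarrow> ('a, 'b) fun_endo \<Rightarrow> ('a, 'b) fun_endo"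
  is "\<lambda>F G x i. F x i - G x i" by (simp add: fun_eq_iff algebra_simps)

lift_definition times_fun_endo :: "('a, 'b) fun_endo \<Rightarrow> ('a, 'b) fun_endo \<Rightarrow> ('a, 'b) fun_endo"
  is "\<lambda>F G x. F (G x)" by simp

instance
proof
  show "(0 :: ('a, 'b) fun_endo) \<noteq> 1"
    by transfer (auto simp: fun_eq_iff intro!: exI [of _ "\<lambda>_. 1"])
qed (transfer; simp add: fun_eq_iff algebra_simps)+

end

lift_definition weighted_shift :: "('i::ab_group_add \<Rightarrow> 'a::ring_1) \<Rightarrow> 'i \<Rightarrow> ('i, 'a) fun_endo"
  is "\<lambda>c e x d. c d * x (d + e)" by (simp add: distrib_left)

lemma weighted_shift_one: "weighted_shift (\<lambda>d. 1) 0 = 1"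
  by transfer simp

lemma weighted_shift_add:
  "weighted_shift c e + weighted_shift c' e = weighted_shift (\<lambda>d. c d + c' d) e"
  by transfer (simp add: distrib_right)

lemma weighted_shift_mult:
  "weighted_shift c e * weighted_shift c' e' = weighted_shift (\<lambda>d. c d * c' (d + e)) (e + e')"
  by transfer (simp add: mult.assoc add.assoc)

lemma weighted_shift_eq_0: "weighted_shift c e = 0 \<Longrightarrow> c d = 0"
proof (transfer fixing: c e d)
  assume "(\<lambda>x d. c d * x (d + e)) = (\<lambda>x i. 0)"
  from fun_cong [OF fun_cong [OF this, of "\<lambda>_. 1"], of d] show "c d = 0"
    by simp
qed

lemma lattice_fun_eq:
  fixes F :: "int ^ 'n \<Rightarrow> 'a" and x y :: "int ^ 'n"
  assumes step: "\<And>k d. k \<notin> S \<Longrightarrow> F (d + axis k 1) = F d"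
    and agree: "\<And>k. k \<in> S \<Longrightarrow> x $ k = y $ k"
  shows "F x = F y"
proof -
  have axis_add: "axis k (a + b) = axis k a + (axis k b :: int ^ 'n)" for k a b
    by (simp add: vec_eq_iff axis_def)
  have multi_step: "F (d + axis k z) = F d" if "k \<notin> S" for k z d
  proof (induction z arbitrary: d rule: int_induct [where k = 0])
    case base
    have "axis k 0 = (0 :: int ^ 'n)"
      by (simp add: vec_eq_iff axis_def)
    then show ?case by (simp only: add.right_neutral)
  next
    case (step1 i)
    then show ?case
      using step [OF that, of "d + axis k i"] by (simp add: axis_add add.assoc)
  next
    case (step2 i)
    then show ?case
      using step [OF that, of "d + axis k (i - 1)"]
      by (simp add: add.assoc axis_add [of k "i - 1" 1, simplified])
  qed
  have "F (x + (\<Sum>k\<in>B. axis k (y $ k - x $ k))) = F x" if "B \<subseteq> - S" for B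
    using finite [of B] that
  proof (induction B)
    case (insert k B)
    then have "k \<notin> S" by blast
    from multi_step [OF this, of "x + (\<Sum>k\<in>B. axis k (y $ k - x $ k))"] insert show ?case
      by (simp add: ac_simps)
  qed simp
  moreover have "y = x + (\<Sum>k\<in>- S. axis k (y $ k - x $ k))"
    using agree by (auto simp: vec_eq_iff axis_def if_distrib sum.delta cong: if_cong)
  ultimately show ?thesis
    by (metis order_refl)
qed

text \<open>
  The lattice points index a basis on which \<open>R\<close> acts diagonally by the characters \<open>\<rho> d\<close> and
  \<open>X\<^sub>i\<^sup>+\<close> by weighted shifts. The weights \<open>g\<close> are forced, up to gauge, by the commutation of
  \<open>X\<^sub>i\<^sup>+\<close> with \<open>X\<^sub>j\<^sup>-\<close>; the two consistency conditions say that this discrete curl equation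
  is solvable.
\<close>

locale TGW_characters =
  fixes h :: "'n::finite \<Rightarrow> 'r::ring_1 \<Rightarrow> 'r" and t :: "'n \<Rightarrow> 'r"
    and \<rho> :: "int ^ 'n \<Rightarrow> 'r \<Rightarrow> 'a::field" and T :: "'n \<Rightarrow> int ^ 'n \<Rightarrow> 'a"
  assumes hom: "unital_hom (\<rho> d)"
    and shift: "\<rho> (d + axis i 1) (half h Pos i r) = \<rho> d (half h Neg i r)"
    and T_eq: "T i d = \<rho> d (half h Pos i (t i))"
    and T_nonzero: "T i d \<noteq> 0"
    and consistent2: "i \<noteq> j \<Longrightarrow> T j (d + axis j 1) * T i (d + axis i 1) =
      T j (d + axis i 1 + axis j 1) * T i (d + axis i 1 + axis j 1)"
    and consistent3: "i \<noteq> j \<Longrightarrow> j \<noteq> k \<Longrightarrow> k \<noteq> i \<Longrightarrow>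
      T k (d + axis i 1 + axis j 1) * T k d = T k (d + axis i 1) * T k (d + axis j 1)"
begin

definition g :: "'n \<Rightarrow> int ^ 'n \<Rightarrow> 'a"
  where "g j d = (\<Prod>l | to_nat l < to_nat j. T j (axis l (d $ l) + axis j (d $ j + 1)))"

lemma g_nonzero: "g j d \<noteq> 0"
  by (simp add: g_def T_nonzero)

lemma T_ratio:
  fixes x y :: "int ^ 'n"
  assumes "i \<noteq> j" and "x $ i = y $ i" and "x $ j = y $ j"
  shows "T j (x + axis i 1) * T j y = T j x * T j (y + axis i 1)"
proof -
  have "T j (x + axis i 1) / T j x = T j (y + axis i 1) / T j y"
  proof (rule lattice_fun_eq [where S = "{i, j}"])
    fix k d assume "k \<notin> {i, j}"
    then show "T j (d + axis k 1 + axis i 1) / T j (d + axis k 1) = T j (d + axis i 1) / T j d"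
      using consistent3 [of k i j d] \<open>i \<noteq> j\<close> by (auto simp: field_simps T_nonzero)
  qed (use assms in auto)
  then show ?thesis
    by (simp add: field_simps T_nonzero)
qed

lemma g_step:
  assumes "to_nat i < to_nat j"
  shows "g j (d + axis i 1) * T j (d + axis j 1) = g j d * T j (d + axis i 1 + axis j 1)"
proof -
  from assms have ij: "i \<noteq> j" by auto
  let ?L = "{l. to_nat l < to_nat j}"
  have split: "g j d = T j (axis i (d $ i) + axis j (d $ j + 1)) *
      (\<Prod>l\<in>?L - {i}. T j (axis l (d $ l) + axis j (d $ j + 1)))" for d
    unfolding g_def using assms by (intro prod.remove) auto
  have "(\<Prod>l\<in>?L - {i}. T j (axis l ((d + axis i 1) $ l) + axis j ((d + axis i 1) $ j + 1))) =
      (\<Prod>l\<in>?L - {i}. T j (axis l (d $ l) + axis j (d $ j + 1)))"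
    using ij by (intro prod.cong) (auto simp: axis_def)
  moreover have "T j (axis i ((d + axis i 1) $ i) + axis j ((d + axis i 1) $ j + 1)) * T j (d + axis j 1) =
      T j (axis i (d $ i) + axis j (d $ j + 1)) * T j (d + axis i 1 + axis j 1)"
  proof -
    have "axis i ((d + axis i 1) $ i) + axis j ((d + axis i 1) $ j + 1) =
        axis i (d $ i) + axis j (d $ j + 1) + axis i 1"
      using ij by (auto simp: vec_eq_iff axis_def)
    moreover have "d + axis i 1 + axis j 1 = (d + axis j 1) + axis i 1"
      by simp
    ultimately show ?thesis
      using ij by (simp only:, intro T_ratio) (auto simp: axis_def)
  qed
  ultimately show ?thesis
    unfolding split by (simp add: mult.commute mult.left_commute)
qed

lemma g_invariant:
  assumes "\<not> to_nat i < to_nat j" and "i \<noteq> j"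
  shows "g j (d + axis i 1) = g j d"
proof -
  have "(d + axis i 1) $ l = d $ l" if "l \<noteq> i" for l
    using that by (simp add: axis_def)
  then show ?thesis
    unfolding g_def using assms by (intro prod.cong refl) (metis mem_Collect_eq)
qed

lemma g_curl:
  assumes "i \<noteq> j"
  shows "g i d * T j (d + axis j 1) * g j (d + axis i 1) =
    T j (d + axis i 1 + axis j 1) * g i (d + axis j 1) * g j d"
proof (cases "to_nat i < to_nat j")
  case True
  then have "g i (d + axis j 1) = g i d"
    using assms by (intro g_invariant) auto
  with g_step [OF True, of d] show ?thesis
    by (simp add: ac_simps)
next
  case False
  then have "to_nat j < to_nat i"
    using assms by (metis linorder_neqE_nat to_nat_split)
  from g_step [OF this, of d] have step: "g i (d + axis j 1) * T i (d + axis i 1) =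
      g i d * T i (d + axis i 1 + axis j 1)"
    by (simp add: ac_simps)
  have "g i d * T j (d + axis j 1) * T i (d + axis i 1) =
      T j (d + axis i 1 + axis j 1) * (g i d * T i (d + axis i 1 + axis j 1))"
    using consistent2 [OF assms, of d] by (simp add: mult.assoc)
  also have "\<dots> = T j (d + axis i 1 + axis j 1) * g i (d + axis j 1) * T i (d + axis i 1)"
    by (simp only: step [symmetric] mult.assoc)
  finally have "g i d * T j (d + axis j 1) = T j (d + axis i 1 + axis j 1) * g i (d + axis j 1)"
    using T_nonzero by simp
  then show ?thesis
    using g_invariant [OF False assms] by simp
qed

fun action :: "('n, 'r) letter \<Rightarrow> (int ^ 'n, 'a) fun_endo" where
  "action (Coef r) = weighted_shift (\<lambda>d. \<rho> d r) 0"
| "action (Xgen Pos i) = weighted_shift (\<lambda>d. g i (d - axis i 1)) (- axis i 1)"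
| "action (Xgen Neg i) = weighted_shift (\<lambda>d. T i (d + axis i 1) / g i d) (axis i 1)"

lemma action_commute:
  assumes "i \<noteq> j"
  shows "action (Xgen Pos i) * action (Xgen Neg j) = action (Xgen Neg j) * action (Xgen Pos i)"
proof -
  have "g i (d - axis i 1) * (T j (d + - axis i 1 + axis j 1) / g j (d + - axis i 1)) =
      T j (d + axis j 1) / g j d * g i (d + axis j 1 - axis i 1)" for d
    using g_curl [OF assms, of "d - axis i 1"] by (simp add: field_simps g_nonzero)
  then show ?thesis
    by (simp add: weighted_shift_mult add.commute)
qed

lemma action_relation:
  assumes "f \<in> tgw_relations h t"
  shows "free_lift action f = 0"
proof -
  interpret unital_hom "free_lift action" by (rule unital_hom_free_lift)
  interpret \<rho>: unital_hom "\<rho> d" for d by (rule hom)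
  show ?thesis
    using assms
  proof cases
    case coef_one
    then show ?thesis by (simp add: weighted_shift_one)
  next
    case coef_add
    then show ?thesis by (simp add: weighted_shift_add)
  next
    case coef_mult
    then show ?thesis by (simp add: weighted_shift_mult)
  next
    case (X_same e i)
    then show ?thesis
      using shift [of "_ - axis i 1" i "t i"] shift [of _ i "t i"]
      by (cases e) (simp_all add: weighted_shift_mult T_eq g_nonzero)
  next
    case (X_distinct i j e)
    then show ?thesis
      using action_commute [of i j] action_commute [of j i] by (cases e) simp_all
  next
    case (X_coef e i r)
    have "\<rho> d (half h Pos i r) = \<rho> (d - axis i 1) (half h Neg i r)" for d
      using shift [of "d - axis i 1" i r] by simp
    then show ?thesis
      using X_coef shift [of _ i r]
      by (cases e) (simp_all add: weighted_shift_mult mult.commute)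
  qed
qed

lemma Coef_in_relation_ideal:
  assumes "gen (Coef r) \<in> tgw_relation_ideal h t"
  shows "\<rho> d r = 0"
proof -
  have "two_sided_ideal (free_lift action -` {0})"
    by (intro unital_hom.two_sided_ideal_vimage unital_hom_free_lift) (simp add: two_sided_ideal_def)
  then have "tgw_relation_ideal h t \<subseteq> free_lift action -` {0}"
    by (rule tgw_relation_ideal_least) (auto simp: action_relation)
  with assms have "weighted_shift (\<lambda>d. \<rho> d r) 0 = 0"
    by auto
  then show ?thesis
    by (rule weighted_shift_eq_0)
qed

end

lemma TGW_Coef_injective:
  fixes \<alpha> :: "'k::field_char_0 ^ 'n::finite ^ 'm::finite" and p :: "'n \<Rightarrow> ('m, 'k) mpoly"
  assumes "tgw_datum (half_shift \<alpha>) p" and "consistent (half_shift \<alpha>) p"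
    and "gen (Coef r) \<in> tgw_relation_ideal (half_shift \<alpha>) p"
  shows "r = 0"
proof -
  obtain \<iota> :: "('m, 'k) mpoly \<Rightarrow> ((nat \<Rightarrow>\<^sub>0 nat) \<Rightarrow>\<^sub>0 'k) fract"
    where "unital_hom \<iota>" and "inj \<iota>"
    using embedding_into_field by blast
  interpret \<iota>: unital_hom \<iota> by fact
  define v :: "int ^ 'n \<Rightarrow> 'm \<Rightarrow> 'k"
    where "v d j = - (\<Sum>i\<in>UNIV. of_int (d $ i) * \<alpha> $ j $ i)" for d j
  have v_axis: "v (d + axis i 1) j = v d j - \<alpha> $ j $ i" for d i j
    by (simp add: v_def axis_def distrib_right sum.distrib if_distrib [of of_int] if_distrib [of "\<lambda>x. x * _"]
        sum.delta cong: if_cong)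
  have v_axis2: "v (d + (axis i 1 + axis i' 1)) j = v d j - \<alpha> $ j $ i - \<alpha> $ j $ i'" for d i i' j
    by (simp add: v_axis flip: add.assoc)
  define \<rho> where "\<rho> d f = \<iota> (translation (v d) f)" for d f
  define T where "T i d = \<rho> d (half (half_shift \<alpha>) Pos i (p i))" for i d
  have translate: "translation u a * translation w b = translation u' a' * translation w' b'"
    if "translation x a * translation y b = translation x' a' * translation y' b'"
      and "u = (\<lambda>j. z j + x j)" "w = (\<lambda>j. z j + y j)" "u' = (\<lambda>j. z j + x' j)" "w' = (\<lambda>j. z j + y' j)"
    for u w u' w' x y x' y' z :: "'m \<Rightarrow> 'k" and a b a' b'
  proof -
    interpret t: unital_hom "translation z" by (rule unital_hom_translation)
    show ?thesis
      using arg_cong [OF that(1), of "translation z"] that(2-5) by (simp add: translation_translation)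
  qed
  interpret TGW_characters "half_shift \<alpha>" p \<rho> T
  proof
    show "\<rho> d 1 = 1" "\<rho> d (x + y) = \<rho> d x + \<rho> d y" "\<rho> d (x * y) = \<rho> d x * \<rho> d y" for d x y
    proof -
      interpret t: unital_hom "translation (v d)" by (rule unital_hom_translation)
      show "\<rho> d 1 = 1" "\<rho> d (x + y) = \<rho> d x + \<rho> d y" "\<rho> d (x * y) = \<rho> d x * \<rho> d y"
        by (simp_all add: \<rho>_def)
    qed
    show "\<rho> (d + axis i 1) (half (half_shift \<alpha>) Pos i r) = \<rho> d (half (half_shift \<alpha>) Neg i r)" for d i r
      by (simp add: \<rho>_def half_half_shift translation_translation v_axis del: half.simps)
    show "T i d = \<rho> d (half (half_shift \<alpha>) Pos i (p i))" for i d
      by (rule T_def)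
    show "T i d \<noteq> 0" for i d
    proof -
      interpret t: unital_hom "translation w :: ('m, 'k) mpoly \<Rightarrow> _" for w by (rule unital_hom_translation)
      have "translation w (p i) \<noteq> translation w 0" for w
        using assms(1) bij_translation [of w] by (metis bij_pointE tgw_datum_def)
      then have "\<iota> (translation w (p i)) \<noteq> \<iota> 0" for w
        using \<open>inj \<iota>\<close> by (metis t.zero injD)
      then show ?thesis
        by (simp add: T_def \<rho>_def half_half_shift translation_translation del: half.simps)
    qed
    fix i j k :: 'n and d
    show "T j (d + axis j 1) * T i (d + axis i 1) =
        T j (d + axis i 1 + axis j 1) * T i (d + axis i 1 + axis j 1)" if "i \<noteq> j"
    proof -
      have "translation (\<lambda>l. \<alpha> $ l $ i / 2) (p j) * translation (\<lambda>l. \<alpha> $ l $ j / 2) (p i) =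
          translation (\<lambda>l. - (\<alpha> $ l $ i / 2)) (p j) * translation (\<lambda>l. - (\<alpha> $ l $ j / 2)) (p i)"
        using assms(2) that unfolding consistent_def half_half_shift by (metis mult.commute)
      then show ?thesis
        unfolding T_def \<rho>_def half_half_shift translation_translation \<iota>.mult [symmetric]
        by (intro arg_cong [of _ _ \<iota>], rule translate [where z = "\<lambda>l. v d l - \<alpha> $ l $ i / 2 - \<alpha> $ l $ j / 2"])
          (auto simp: v_axis v_axis2 fun_eq_iff field_simps)
    qed
    show "T k (d + axis i 1 + axis j 1) * T k d = T k (d + axis i 1) * T k (d + axis j 1)"
      if "i \<noteq> j" "j \<noteq> k" "k \<noteq> i"
    proof -
      let ?h = "half (half_shift \<alpha>)"
      have "?h Pos i (?h Pos j (p k)) * ?h Neg i (?h Neg j (p k)) =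
          ?h Pos i (?h Neg j (p k)) * ?h Neg i (?h Pos j (p k))"
        using that by (intro assms(2) [unfolded consistent_def, THEN conjunct2, rule_format] conjI)
      note eq = this [unfolded half_half_shift translation_translation]
      have "T k d * T k (d + axis i 1 + axis j 1) = T k (d + axis j 1) * T k (d + axis i 1)"
        unfolding T_def \<rho>_def half_half_shift translation_translation \<iota>.mult [symmetric]
        by (intro arg_cong [of _ _ \<iota>],
            rule translate [OF eq, where z = "\<lambda>l. v d l + \<alpha> $ l $ k / 2 - \<alpha> $ l $ i / 2 - \<alpha> $ l $ j / 2"])
          (auto simp: v_axis v_axis2 fun_eq_iff field_simps)
      then show ?thesis
        by (simp only: mult.commute)
    qed
  qed
  have "\<rho> 0 r = 0"
    by (rule Coef_in_relation_ideal) fact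
  then have "\<iota> r = \<iota> 0"
    by (simp add: \<rho>_def v_def [abs_def])
  then show ?thesis
    by (rule injD [OF \<open>inj \<iota>\<close>])
qed

section \<open>Components of low degree\<close>

lemma single_word_Cons:
  "Poly_Mapping.single (Word (x # xs)) (1 :: int) = gen x * Poly_Mapping.single (Word xs) 1"
  by (simp add: gen_def mult_single plus_word_def)

lemma single_word_coefficient:
  "Poly_Mapping.single w (c :: int) = of_int c * Poly_Mapping.single (w :: 'g word) 1"
  by (simp add: mult_single flip: single_of_int)

lemma homogeneous_expand:
  assumes "homogeneous d f"
  obtains A where "finite A" and "\<And>w. w \<in> A \<Longrightarrow> word_degree w = d"
    and "f = (\<Sum>w\<in>A. of_int (Poly_Mapping.lookup f w) * Poly_Mapping.single w 1)"
proof
  show "f = (\<Sum>w\<in>Poly_Mapping.keys f. of_int (Poly_Mapping.lookup f w) * Poly_Mapping.single w 1)"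
    by (simp flip: single_word_coefficient poly_mapping_sum_single)
qed (use assms in \<open>auto simp: homogeneous_def\<close>)

locale TGW_relations =
  fixes h :: "'n::finite \<Rightarrow> 'r::comm_ring_1 \<Rightarrow> 'r" and t :: "'n \<Rightarrow> 'r"
  assumes bij_h: "bij (h i)"
begin

sublocale two_sided_ideal "tgw_relation_ideal h t"
  by (rule two_sided_ideal_relation_ideal)

abbreviation coef :: "'r \<Rightarrow> ('n, 'r) letter free_ring"
  where "coef r \<equiv> gen (Coef r)"

abbreviation xgen :: "sign \<Rightarrow> 'n \<Rightarrow> ('n, 'r) letter free_ring"
  where "xgen e i \<equiv> gen (Xgen e i)"

abbreviation rel_cong (infix "\<approx>" 50)
  where "f \<approx> g \<equiv> cong f g"

lemma relation_cong: "f - g \<in> tgw_relations h t \<Longrightarrow> f \<approx> g"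
  using tgw_relations_subset by (auto simp: cong_def)

lemma coef_one_cong: "coef 1 \<approx> 1"
  by (intro relation_cong tgw_relations.coef_one)

lemma coef_add_cong: "coef (r + s) \<approx> coef r + coef s"
  by (intro relation_cong tgw_relations.coef_add)

lemma coef_mult_cong: "coef (r * s) \<approx> coef r * coef s"
  by (intro relation_cong tgw_relations.coef_mult)

lemma X_same_cong: "xgen e i * xgen (opp e) i \<approx> coef (half h e i (t i))"
  by (intro relation_cong tgw_relations.X_same)

lemma X_distinct_cong: "i \<noteq> j \<Longrightarrow> xgen e i * xgen (opp e) j \<approx> xgen (opp e) j * xgen e i"
  by (intro relation_cong tgw_relations.X_distinct)

lemma X_coef_cong: "xgen e i * coef (half h (opp e) i r) \<approx> coef (half h e i r) * xgen e i"
  by (intro relation_cong tgw_relations.X_coef)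

lemma coef_zero_cong: "coef 0 \<approx> 0"
  using uminus_mem [OF coef_add_cong [of 0 0, unfolded cong_def]] by (simp add: cong_def)

lemma coef_uminus_cong: "coef (- r) \<approx> - coef r"
proof -
  have "coef (- r) + coef r \<approx> 0"
    using cong_trans [OF cong_sym [OF coef_add_cong [of "- r" r]]] coef_zero_cong by simp
  then show ?thesis
    by (simp add: cong_def)
qed

lemma coef_of_int_cong: "coef (of_int c) \<approx> of_int c"
proof -
  have nat: "coef (of_nat n) \<approx> of_nat n" for n
  proof (induction n)
    case (Suc n)
    then show ?case
      using cong_trans [OF coef_add_cong cong_add [OF coef_one_cong]] by simp
  qed (simp add: coef_zero_cong)
  show ?thesis
  proof (cases c)
    case (nonneg n)
    then show ?thesis using nat by simp
  next
    case (neg n)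
    have "- coef (of_nat (Suc n)) \<approx> - of_nat (Suc n)"
      using cong_lmult [OF nat [of "Suc n"], of "- 1"] by simp
    with neg show ?thesis
      using cong_trans [OF coef_uminus_cong [of "of_nat (Suc n)"]]
      by (simp only: of_int_minus of_int_of_nat_eq)
  qed
qed

lemma bij_half: "bij (half h e i)"
  by (cases e) (simp_all add: bij_h bij_imp_bij_inv)

lemma X_past_coef: "\<exists>s. xgen e i * coef r \<approx> coef s * xgen e i"
proof -
  obtain r' where "r = half h (opp e) i r'"
    using bij_half [of "opp e" i] by (meson bij_pointE)
  then show ?thesis
    using X_coef_cong by blast
qed

definition block :: "sign \<Rightarrow> 'n list \<Rightarrow> ('n, 'r) letter free_ring"
  where "block e xs = prod_list (map (xgen e) xs)"

lemma block_simps [simp]: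
  "block e [] = 1" "block e (i # xs) = xgen e i * block e xs" "block e (xs @ ys) = block e xs * block e ys"
  by (simp_all add: block_def)

lemma block_past_coef: "\<exists>s. block e xs * coef r \<approx> coef s * block e xs"
proof (induction xs)
  case (Cons i xs)
  then obtain s where s: "block e xs * coef r \<approx> coef s * block e xs" by blast
  obtain s' where s': "xgen e i * coef s \<approx> coef s' * xgen e i" using X_past_coef by blast
  have "xgen e i * block e xs * coef r \<approx> xgen e i * coef s * block e xs"
    using cong_lmult [OF s] by (simp add: mult.assoc)
  also have "\<dots> \<approx> coef s' * xgen e i * block e xs"
    using s' by (rule cong_rmult)
  finally show ?case by (auto simp: mult.assoc)
qed (auto intro: exI [of _ r])

lemma X_past_block: "i \<notin> set xs \<Longrightarrow> xgen e i * block (opp e) xs \<approx> block (opp e) xs * xgen e i"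
proof (induction xs)
  case (Cons j xs)
  then have "xgen e i * xgen (opp e) j * block (opp e) xs \<approx> xgen (opp e) j * xgen e i * block (opp e) xs"
    by (intro cong_rmult X_distinct_cong) auto
  also have "\<dots> \<approx> xgen (opp e) j * (block (opp e) xs * xgen e i)"
    unfolding mult.assoc using Cons by (intro cong_lmult) auto
  finally show ?case by (simp add: mult.assoc)
qed simp

lemma block_commute:
  "set xs \<inter> set ys = {} \<Longrightarrow> block e xs * block (opp e) ys \<approx> block (opp e) ys * block e xs"
proof (induction xs)
  case (Cons i xs)
  then have "xgen e i * (block e xs * block (opp e) ys) \<approx> xgen e i * (block (opp e) ys * block e xs)"
    by (intro cong_lmult) auto
  also have "\<dots> = xgen e i * block (opp e) ys * block e xs"
    by (simp add: mult.assoc)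
  also have "\<dots> \<approx> block (opp e) ys * xgen e i * block e xs"
    using Cons.prems by (intro cong_rmult X_past_block) auto
  finally show ?case by (simp add: mult.assoc)
qed simp

lemma X_mult_blocks:
  assumes "set xs \<inter> set ys = {}"
  obtains r xs' ys' where "xgen e i * (block e xs * block (opp e) ys) \<approx> coef r * (block e xs' * block (opp e) ys')"
    and "set xs' \<inter> set ys' = {}"
    and "\<And>k. int (count_list xs' k) - int (count_list ys' k) =
      (if k = i then 1 else 0) + int (count_list xs k) - int (count_list ys k)"
proof (cases "i \<in> set ys")
  case False
  have "xgen e i * (block e xs * block (opp e) ys) \<approx> coef 1 * (block e (i # xs) * block (opp e) ys)"
    using cong_rmult [OF cong_sym [OF coef_one_cong]] by (simp add: mult.assoc)
  then show thesis
    using False assms by (intro that [of 1 "i # xs" ys]) auto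
next
  case True
  then obtain us vs where ys: "ys = us @ i # vs" and us: "i \<notin> set us"
    by (meson split_list_first)
  obtain s where s: "block (opp e) us * coef (half h e i (t i)) \<approx> coef s * block (opp e) us"
    using block_past_coef by blast
  have disj: "set xs \<inter> set (us @ vs) = {}"
    using assms ys by auto
  have "xgen e i * (block e xs * block (opp e) ys) \<approx> xgen e i * (block (opp e) ys * block e xs)"
    by (intro cong_lmult block_commute assms)
  also have "\<dots> = xgen e i * block (opp e) us * (xgen (opp e) i * block (opp e) vs * block e xs)"
    by (simp add: ys mult.assoc)
  also have "\<dots> \<approx> block (opp e) us * xgen e i * (xgen (opp e) i * block (opp e) vs * block e xs)"
    by (intro cong_rmult X_past_block us)
  also have "\<dots> = block (opp e) us * (xgen e i * xgen (opp e) i) * (block (opp e) vs * block e xs)"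
    by (simp add: mult.assoc)
  also have "\<dots> \<approx> block (opp e) us * coef (half h e i (t i)) * (block (opp e) vs * block e xs)"
    by (intro cong_rmult cong_lmult X_same_cong)
  also have "\<dots> \<approx> coef s * block (opp e) us * (block (opp e) vs * block e xs)"
    by (intro cong_rmult s)
  also have "\<dots> = coef s * (block (opp e) (us @ vs) * block e xs)"
    by (simp add: mult.assoc)
  also have "\<dots> \<approx> coef s * (block e xs * block (opp e) (us @ vs))"
    by (intro cong_lmult cong_sym [OF block_commute] disj)
  finally show thesis
    using disj ys by (intro that [of s xs "us @ vs"]) auto
qed

lemma word_normal_form:
  "\<exists>r xs ys. Poly_Mapping.single w 1 \<approx> coef r * (block Pos xs * block Neg ys) \<and>
    set xs \<inter> set ys = {} \<and>
    (\<forall>k. word_degree w $ k = int (count_list xs k) - int (count_list ys k))"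
proof (cases w)
  case (Word ls)
  show ?thesis
    unfolding Word
  proof (induction ls)
    case Nil
    have "Poly_Mapping.single (Word []) 1 \<approx> coef 1 * (block Pos [] * block Neg [])"
      using cong_sym [OF coef_one_cong] by (simp flip: zero_word_def)
    then show ?case
      by (intro exI [of _ 1] exI [of _ "[]"]) simp
  next
    case (Cons l ls)
    then obtain r xs ys where IH: "Poly_Mapping.single (Word ls) 1 \<approx> coef r * (block Pos xs * block Neg ys)"
      and disj: "set xs \<inter> set ys = {}"
      and deg: "\<And>k. word_degree (Word ls) $ k = int (count_list xs k) - int (count_list ys k)"
      by blast
    have step: "Poly_Mapping.single (Word (l # ls)) 1 \<approx> gen l * (coef r * (block Pos xs * block Neg ys))"
      unfolding single_word_Cons by (intro cong_lmult IH)
    show ?case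
    proof (cases l)
      case (Coef s)
      have "gen l * (coef r * (block Pos xs * block Neg ys)) \<approx> coef (s * r) * (block Pos xs * block Neg ys)"
        unfolding Coef mult.assoc [symmetric] by (intro cong_rmult cong_sym [OF coef_mult_cong])
      from cong_trans [OF step this] show ?thesis
        using disj deg Coef by (intro exI [of _ "s * r"] exI [of _ xs] exI [of _ ys]) simp
    next
      case (Xgen e i)
      obtain s where s: "xgen e i * coef r \<approx> coef s * xgen e i"
        using X_past_coef by blast
      have "gen l * (coef r * (block Pos xs * block Neg ys)) = xgen e i * coef r * (block Pos xs * block Neg ys)"
        by (simp add: Xgen mult.assoc)
      also have "\<dots> \<approx> coef s * xgen e i * (block Pos xs * block Neg ys)"
        by (intro cong_rmult s)
      finally have split: "Poly_Mapping.single (Word (l # ls)) 1 \<approx> coef s * (xgen e i * (block Pos xs * block Neg ys))"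
        using cong_trans [OF step] by (simp add: mult.assoc)
      have "\<exists>r' xs' ys'. xgen e i * (block Pos xs * block Neg ys) \<approx> coef r' * (block Pos xs' * block Neg ys') \<and>
          set xs' \<inter> set ys' = {} \<and>
          (\<forall>k. word_degree (Word (l # ls)) $ k = int (count_list xs' k) - int (count_list ys' k))"
      proof (cases e)
        case Pos
        obtain r' xs' ys' where "xgen Pos i * (block Pos xs * block (opp Pos) ys) \<approx>
            coef r' * (block Pos xs' * block (opp Pos) ys')"
          and "set xs' \<inter> set ys' = {}"
          and "\<And>k. int (count_list xs' k) - int (count_list ys' k) =
            (if k = i then 1 else 0) + int (count_list xs k) - int (count_list ys k)"
          by (rule X_mult_blocks [OF disj, where e = Pos and i = i]) (rule that)
        then show ?thesis
          using Pos Xgen deg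
          by (intro exI [of _ r'] exI [of _ xs'] exI [of _ ys']) (auto simp: axis_def)
      next
        case Neg
        obtain r' ys' xs' where *: "xgen Neg i * (block Neg ys * block (opp Neg) xs) \<approx>
            coef r' * (block Neg ys' * block (opp Neg) xs')"
          and disj': "set ys' \<inter> set xs' = {}"
          and deg': "\<And>k. int (count_list ys' k) - int (count_list xs' k) =
            (if k = i then 1 else 0) + int (count_list ys k) - int (count_list xs k)"
          by (rule X_mult_blocks [OF trans [OF Int_commute disj], where e = Neg and i = i]) (rule that)
        have "xgen Neg i * (block Pos xs * block Neg ys) \<approx> xgen Neg i * (block Neg ys * block Pos xs)"
          using block_commute [OF disj, of Pos] by (intro cong_lmult) simp
        also have "\<dots> \<approx> coef r' * (block Neg ys' * block Pos xs')"
          using * by simp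
        also have "\<dots> \<approx> coef r' * (block Pos xs' * block Neg ys')"
          using block_commute [OF disj', of Neg] by (intro cong_lmult) simp
        finally have "xgen e i * (block Pos xs * block Neg ys) \<approx> coef r' * (block Pos xs' * block Neg ys')"
          using Neg by simp
        moreover have "word_degree (Word (l # ls)) $ k = int (count_list xs' k) - int (count_list ys' k)" for k
          using deg' [of k] deg [of k] Neg Xgen by (simp add: axis_def split: if_splits)
        moreover have "set xs' \<inter> set ys' = {}"
          using disj' by blast
        ultimately show ?thesis by blast
      qed
      then obtain r' xs' ys' where
        "xgen e i * (block Pos xs * block Neg ys) \<approx> coef r' * (block Pos xs' * block Neg ys')"
        and rest: "set xs' \<inter> set ys' = {}"
          "\<forall>k. word_degree (Word (l # ls)) $ k = int (count_list xs' k) - int (count_list ys' k)"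
        by blast
      then have "coef s * (xgen e i * (block Pos xs * block Neg ys)) \<approx>
          coef s * (coef r' * (block Pos xs' * block Neg ys'))"
        by (intro cong_lmult)
      also have "\<dots> \<approx> coef (s * r') * (block Pos xs' * block Neg ys')"
        unfolding mult.assoc [symmetric] by (intro cong_rmult cong_sym [OF coef_mult_cong])
      finally have "Poly_Mapping.single (Word (l # ls)) 1 \<approx> coef (s * r') * (block Pos xs' * block Neg ys')"
        by (rule cong_trans [OF split])
      with rest show ?thesis by blast
    qed
  qed
qed

lemma count_list_eq_singleton:
  assumes "\<And>k. count_list xs k = (if k = i then 1 else 0)"
  shows "xs = [i]"
proof (cases xs)
  case Nil
  then show ?thesis using assms [of i] by simp
next
  case (Cons x ys)
  then have "x = i"
    using assms [of x] by (auto split: if_splits)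
  have "count_list ys k = 0" for k
    using assms [of k] Cons \<open>x = i\<close> by (auto split: if_splits)
  then have "ys = []"
    by (metis count_list_0_iff list.set_intros(1) neq_Nil_conv)
  with Cons \<open>x = i\<close> show ?thesis by simp
qed

lemma word_degree_zero_cong:
  assumes "word_degree w = 0"
  shows "\<exists>r. Poly_Mapping.single w 1 \<approx> coef r * 1"
proof -
  obtain r xs ys where w: "Poly_Mapping.single w 1 \<approx> coef r * (block Pos xs * block Neg ys)"
    and disj: "set xs \<inter> set ys = {}"
    and deg: "\<And>k. word_degree w $ k = int (count_list xs k) - int (count_list ys k)"
    using word_normal_form by blast
  have "count_list xs k = 0 \<or> count_list ys k = 0" for k
    using disj by (auto simp: count_list_0_iff)
  then have "count_list xs k = 0" "count_list ys k = 0" for k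
    using deg [of k] assms by force+
  then have "k \<notin> set xs" "k \<notin> set ys" for k
    by (simp_all add: count_list_0_iff)
  then have "xs = []" "ys = []"
    by (metis list.set_intros(1) neq_Nil_conv)+
  with w show ?thesis by auto
qed

lemma word_degree_X_cong:
  assumes "word_degree w = letter_degree (Xgen e i :: ('n, 'r) letter)"
  shows "\<exists>r. Poly_Mapping.single w 1 \<approx> coef r * xgen e i"
proof -
  obtain r xs ys where w: "Poly_Mapping.single w 1 \<approx> coef r * (block Pos xs * block Neg ys)"
    and disj: "set xs \<inter> set ys = {}"
    and deg: "\<And>k. word_degree w $ k = int (count_list xs k) - int (count_list ys k)"
    using word_normal_form by blast
  have either: "count_list xs k = 0 \<or> count_list ys k = 0" for k
    using disj by (auto simp: count_list_0_iff)
  show ?thesis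
  proof (cases e)
    case Pos
    have *: "int (count_list xs k) - int (count_list ys k) = (if k = i then 1 else 0)" for k
      using deg [of k] assms Pos by (simp add: axis_def)
    have "count_list xs k = (if k = i then 1 else 0)" "count_list ys k = 0" for k
      using * [of k] either [of k] by (auto split: if_splits)
    then have "xs = [i]" "ys = []"
      by (simp_all add: count_list_eq_singleton) (metis count_list_0_iff list.set_intros(1) neq_Nil_conv)
    with w Pos show ?thesis by auto
  next
    case Neg
    have *: "int (count_list xs k) - int (count_list ys k) = (if k = i then - 1 else 0)" for k
      using deg [of k] assms Neg by (auto simp: axis_def split: if_splits)
    have "count_list ys k = (if k = i then 1 else 0)" "count_list xs k = 0" for k
      using * [of k] either [of k] by (auto split: if_splits)
    then have "ys = [i]" "xs = []"
      by (simp_all add: count_list_eq_singleton) (metis count_list_0_iff list.set_intros(1) neq_Nil_conv)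
    with w Neg show ?thesis by auto
  qed
qed

lemma homogeneous_cong:
  assumes "homogeneous d f" and words: "\<And>w. word_degree w = d \<Longrightarrow> \<exists>r. Poly_Mapping.single w 1 \<approx> coef r * m"
  shows "\<exists>r. f \<approx> coef r * m"
proof -
  obtain A where A: "finite A" "\<And>w. w \<in> A \<Longrightarrow> word_degree w = d"
    and f: "f = (\<Sum>w\<in>A. of_int (Poly_Mapping.lookup f w) * Poly_Mapping.single w 1)"
    using homogeneous_expand [OF assms(1)] by blast
  have "\<exists>r. (\<Sum>w\<in>A. of_int (c w) * Poly_Mapping.single w 1) \<approx> coef r * m" for c
    using A
  proof (induction A)
    case empty
    have "0 \<approx> coef 0 * m"
      using cong_rmult [OF cong_sym [OF coef_zero_cong]] by simp
    then show ?case by auto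
  next
    case (insert w A)
    obtain s where s: "Poly_Mapping.single w 1 \<approx> coef s * m"
      using words insert.prems by blast
    obtain r where r: "(\<Sum>w\<in>A. of_int (c w) * Poly_Mapping.single w 1) \<approx> coef r * m"
      using insert by blast
    have "of_int (c w) * Poly_Mapping.single w 1 \<approx> coef (of_int (c w)) * (coef s * m)"
      by (intro cong_mult cong_sym [OF coef_of_int_cong] s)
    also have "\<dots> \<approx> coef (of_int (c w) * s) * m"
      unfolding mult.assoc [symmetric] by (intro cong_rmult cong_sym [OF coef_mult_cong])
    finally have "(\<Sum>w\<in>insert w A. of_int (c w) * Poly_Mapping.single w 1) \<approx>
        (coef (of_int (c w) * s) + coef r) * m"
      using insert.hyps r by (simp add: cong_add distrib_right)
    also have "\<dots> \<approx> coef (of_int (c w) * s + r) * m"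
      by (intro cong_rmult cong_sym [OF coef_add_cong])
    finally show ?case by blast
  qed
  from this [of "Poly_Mapping.lookup f"] show ?thesis
    by (simp only: f [symmetric])
qed

lemma homogeneous_zero_cong: "homogeneous 0 f \<Longrightarrow> \<exists>r. f \<approx> coef r"
  using homogeneous_cong [OF _ word_degree_zero_cong] by simp

lemma homogeneous_X_cong:
  "homogeneous (letter_degree (Xgen e i :: ('n, 'r) letter)) f \<Longrightarrow> \<exists>r. f \<approx> coef r * xgen e i"
  using homogeneous_cong [OF _ word_degree_X_cong] by blast

lemma TGWA_map_cong: "f \<approx> g \<Longrightarrow> TGWA_map h t f = TGWA_map h t g"
  unfolding TGWA_map_eq_iff cong_def using relation_ideal_subset_TGW_null by blast

lemma TGWA_map_coef_eqD:
  assumes "TGWA_map h t (coef r) = TGWA_map h t (coef s)"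
  shows "coef (r - s) \<in> tgw_relation_ideal h t"
proof -
  have "coef r \<approx> coef s"
    using assms by (simp add: TGWA_map_eq_iff cong_def TGW_null_degree_zero homogeneous_diff)
  then have "coef r + coef (- s) \<approx> coef s + coef (- s)"
    by (rule cong_add) (rule cong_refl)
  then have "coef (r + - s) \<approx> coef (s + - s)"
    by (rule cong_trans [OF cong_trans [OF coef_add_cong] cong_sym [OF coef_add_cong]])
  then have "coef (r - s) \<approx> 0"
    using cong_trans [OF _ coef_zero_cong] by simp
  then show ?thesis
    by (simp add: cong_def)
qed

end

section \<open>Isomorphisms induced by automorphisms of the base ring\<close>

lemma homogeneous_sum: "(\<And>i. i \<in> A \<Longrightarrow> homogeneous d (f i)) \<Longrightarrow> homogeneous d (sum f A)"
  by (induction A rule: infinite_finite_induct) (auto intro: homogeneous_add)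

lemma homogeneous_of_int [simp]: "homogeneous 0 (of_int c)"
  using homogeneous_single [of 0 0 c] by (simp flip: single_of_int)

lemma TGW_null_homogeneous:
  assumes f: "f \<in> TGW_null h t" and "homogeneous a x" and "homogeneous b y" and "a + d + b = 0"
  shows "x * homogeneous_part d f * y \<in> tgw_relation_ideal h t"
proof -
  interpret two_sided_ideal "tgw_relation_ideal h t"
    by (rule two_sided_ideal_relation_ideal)
  obtain A where A: "\<And>v. v \<in> A \<Longrightarrow> word_degree v = a"
    and x: "x = (\<Sum>v\<in>A. of_int (Poly_Mapping.lookup x v) * Poly_Mapping.single v 1)"
    using homogeneous_expand [OF assms(2)] by blast
  obtain B where B: "\<And>w. w \<in> B \<Longrightarrow> word_degree w = b"
    and y: "y = (\<Sum>w\<in>B. of_int (Poly_Mapping.lookup y w) * Poly_Mapping.single w 1)"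
    using homogeneous_expand [OF assms(3)] by blast
  have "(\<Sum>v\<in>A. of_int (c v) * Poly_Mapping.single v 1) * homogeneous_part d f *
      (\<Sum>w\<in>B. of_int (c' w) * Poly_Mapping.single w 1) \<in> tgw_relation_ideal h t" for c c'
    unfolding sum_distrib_left sum_distrib_right
  proof (intro sum_mem)
    fix v w assume "v \<in> A" "w \<in> B"
    then have "Poly_Mapping.single v 1 * homogeneous_part d f * Poly_Mapping.single w 1 \<in> tgw_relation_ideal h t"
      using f A B \<open>a + d + b = 0\<close> by (simp add: TGW_null_def)
    then have "of_int (c v) * (Poly_Mapping.single v 1 * homogeneous_part d f * Poly_Mapping.single w 1) *
        of_int (c' w) \<in> tgw_relation_ideal h t"
      by (rule rmult_mem [OF lmult_mem])
    moreover have "Poly_Mapping.single w 1 * of_int (c' w) =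
        (of_int (c' w) * Poly_Mapping.single w 1 :: ('a, 'b) letter free_ring)"
      by (rule mult_of_int_commute [symmetric])
    ultimately show "of_int (c v) * Poly_Mapping.single v 1 * homogeneous_part d f *
        (of_int (c' w) * Poly_Mapping.single w 1) \<in> tgw_relation_ideal h t"
      by (simp only: mult.assoc)
  qed
  from this [of "Poly_Mapping.lookup x" "Poly_Mapping.lookup y"] show ?thesis
    by (simp only: x [symmetric] y [symmetric])
qed

fun letter_map :: "('r \<Rightarrow> 'r) \<Rightarrow> ('n \<Rightarrow> 'r) \<Rightarrow> ('n, 'r) letter \<Rightarrow> ('n, 'r) letter free_ring" where
  "letter_map \<psi> c (Coef r) = gen (Coef (\<psi> r))"
| "letter_map \<psi> c (Xgen Pos i) = gen (Coef (c i)) * gen (Xgen Pos i)"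
| "letter_map \<psi> c (Xgen Neg i) = gen (Xgen Neg i)"

definition rescale :: "('r \<Rightarrow> 'r) \<Rightarrow> ('n \<Rightarrow> 'r) \<Rightarrow> ('n, 'r) letter free_ring \<Rightarrow> ('n, 'r) letter free_ring"
  where "rescale \<psi> c = free_lift (letter_map \<psi> c)"

interpretation rescale: unital_hom "rescale \<psi> c"
  unfolding rescale_def by (rule unital_hom_free_lift)

lemma rescale_gen [simp]: "rescale \<psi> c (gen x) = letter_map \<psi> c x"
  by (simp add: rescale_def)

lemma homogeneous_letter_map: "homogeneous (letter_degree x) (letter_map \<psi> c x)"
proof (cases x)
  case (Xgen e i)
  then show ?thesis
    using homogeneous_mult [OF homogeneous_gen_Coef homogeneous_gen [of "Xgen Pos i"]]
      homogeneous_gen [of "Xgen Neg i"]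
    by (cases e) auto
qed simp

lemma homogeneous_rescale_word: "homogeneous (word_degree w) (rescale \<psi> c (Poly_Mapping.single w 1))"
proof (cases w)
  case (Word ls)
  show ?thesis
    unfolding Word
  proof (induction ls)
    case Nil
    then show ?case by (simp flip: zero_word_def)
  next
    case (Cons l ls)
    then show ?case
      by (simp only: single_word_Cons rescale.mult rescale_gen word_degree_Word homogeneous_mult homogeneous_letter_map)
  qed
qed

lemma rescale_of_int: "rescale \<psi> c (of_int k) = of_int k"
  by (cases k) simp_all

lemma homogeneous_rescale:
  assumes "homogeneous d f"
  shows "homogeneous d (rescale \<psi> c f)"
proof -
  obtain A where A: "\<And>w. w \<in> A \<Longrightarrow> word_degree w = d"
    and f: "f = (\<Sum>w\<in>A. of_int (Poly_Mapping.lookup f w) * Poly_Mapping.single w 1)"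
    using homogeneous_expand [OF assms] by blast
  have "homogeneous d (rescale \<psi> c (\<Sum>w\<in>A. of_int (k w) * Poly_Mapping.single w 1))" for k
  proof -
    have "homogeneous d (of_int (k w) * rescale \<psi> c (Poly_Mapping.single w 1))" if "w \<in> A" for w
      using homogeneous_mult [OF homogeneous_of_int homogeneous_rescale_word] A [OF that] by fastforce
    then show ?thesis
      unfolding rescale.sum rescale.mult rescale_of_int by (rule homogeneous_sum)
  qed
  from this [of "Poly_Mapping.lookup f"] show ?thesis
    by (simp only: f [symmetric])
qed

lemma homogeneous_part_sum: "homogeneous_part d (sum f A) = (\<Sum>i\<in>A. homogeneous_part d (f i))"
  by (induction A rule: infinite_finite_induct) simp_all

lemma homogeneous_part_rescale: "homogeneous_part d (rescale \<psi> c f) = rescale \<psi> c (homogeneous_part d f)"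
proof -
  let ?D = "word_degree ` Poly_Mapping.keys f"
  have step: "homogeneous_part d (rescale \<psi> c g) = rescale \<psi> c (homogeneous_part d g)" if "homogeneous e g" for g e
    by (simp add: homogeneous_part_homogeneous [OF that] homogeneous_part_homogeneous [OF homogeneous_rescale [OF that]])
  have "homogeneous_part d (rescale \<psi> c (\<Sum>e\<in>?D. homogeneous_part e f)) =
      rescale \<psi> c (homogeneous_part d (\<Sum>e\<in>?D. homogeneous_part e f))"
    by (simp only: rescale.sum homogeneous_part_sum) (intro sum.cong refl step [OF homogeneous_homogeneous_part])
  then show ?thesis
    by (simp only: sum_homogeneous_part [symmetric])
qed

locale TGW_morphism = A: TGW_relations h t + B: TGW_relations h' t'
  for h :: "'n::finite \<Rightarrow> 'r::comm_ring_1 \<Rightarrow> 'r" and t :: "'n \<Rightarrow> 'r"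
    and h' :: "'n \<Rightarrow> 'r \<Rightarrow> 'r" and t' :: "'n \<Rightarrow> 'r" +
  fixes \<psi> :: "'r \<Rightarrow> 'r" and c :: "'n \<Rightarrow> 'r"
  assumes hom: "unital_hom \<psi>"
    and intertwine: "\<psi> (half h e i r) = half h' e i (\<psi> r)"
    and scale: "\<psi> (half h e i (t i)) = c i * half h' e i (t' i)"
    and fixed: "half h' e j (c i) = c i"
begin

interpretation unital_hom \<psi> by (rule hom)

lemma coef_commute: "B.cong (gen (Coef r) * gen (Coef s)) (gen (Coef s) * gen (Coef r))"
  using B.cong_trans [OF B.cong_sym [OF B.coef_mult_cong [of r s]] B.coef_mult_cong [of s r, unfolded mult.commute [of s r]]] .

lemma X_fixed: "B.cong (gen (Xgen e j) * gen (Coef (c i))) (gen (Coef (c i)) * gen (Xgen e j))"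
  using B.X_coef_cong [of e j "c i"] by (simp add: fixed)

lemma rescale_relation:
  assumes "f \<in> tgw_relations h t"
  shows "rescale \<psi> c f \<in> tgw_relation_ideal h' t'"
  using assms
proof cases
  case coef_one
  then show ?thesis using B.coef_one_cong by (simp add: B.cong_def)
next
  case coef_add
  then show ?thesis using B.coef_add_cong by (simp add: B.cong_def)
next
  case coef_mult
  then show ?thesis using B.coef_mult_cong by (simp add: B.cong_def)
next
  case (X_same e i)
  have "B.cong (letter_map \<psi> c (Xgen e i) * letter_map \<psi> c (Xgen (opp e) i))
      (gen (Coef (c i)) * (gen (Xgen e i) * gen (Xgen (opp e) i)))"
    using B.cong_rmult [OF X_fixed [of Neg i i], of "gen (Xgen Pos i)"]
    by (cases e) (simp_all add: mult.assoc)
  also have "B.cong \<dots> (gen (Coef (c i)) * gen (Coef (half h' e i (t' i))))"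
    by (intro B.cong_lmult B.X_same_cong)
  also have "B.cong \<dots> (gen (Coef (c i * half h' e i (t' i))))"
    by (rule B.cong_sym [OF B.coef_mult_cong])
  finally show ?thesis
    using X_same by (simp add: B.cong_def scale)
next
  case (X_distinct i j e)
  have *: "B.cong (gen (Coef (c i)) * gen (Xgen Pos i) * gen (Xgen Neg j))
      (gen (Xgen Neg j) * (gen (Coef (c i)) * gen (Xgen Pos i)))" if "i \<noteq> j" for i j
  proof -
    have "B.cong (gen (Coef (c i)) * (gen (Xgen Pos i) * gen (Xgen Neg j)))
        (gen (Coef (c i)) * (gen (Xgen Neg j) * gen (Xgen Pos i)))"
      using B.X_distinct_cong [OF that, of Pos] by (intro B.cong_lmult) simp
    also have "B.cong \<dots> (gen (Xgen Neg j) * gen (Coef (c i)) * gen (Xgen Pos i))"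
      unfolding mult.assoc [symmetric] by (intro B.cong_rmult B.cong_sym [OF X_fixed])
    finally show ?thesis by (simp add: mult.assoc)
  qed
  show ?thesis
    using * [of i j] B.cong_sym [OF * [of j i]] X_distinct by (cases e) (simp_all add: B.cong_def)
next
  case (X_coef e i r)
  let ?d = "case e of Pos \<Rightarrow> gen (Coef (c i)) | Neg \<Rightarrow> 1"
  have d: "letter_map \<psi> c (Xgen e i) = ?d * gen (Xgen e i)"
    by (cases e) simp_all
  have "B.cong (?d * (gen (Xgen e i) * gen (Coef (half h' (opp e) i (\<psi> r)))))
      (?d * (gen (Coef (half h' e i (\<psi> r))) * gen (Xgen e i)))"
    by (intro B.cong_lmult B.X_coef_cong)
  also have "B.cong \<dots> (gen (Coef (half h' e i (\<psi> r))) * ?d * gen (Xgen e i))"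
    unfolding mult.assoc [symmetric] using coef_commute by (intro B.cong_rmult) (cases e; simp)
  finally have "B.cong (letter_map \<psi> c (Xgen e i) * gen (Coef (half h' (opp e) i (\<psi> r))))
      (gen (Coef (half h' e i (\<psi> r))) * letter_map \<psi> c (Xgen e i))"
    unfolding d by (simp add: mult.assoc)
  then show ?thesis
    using X_coef by (simp add: B.cong_def intertwine)
qed

lemma rescale_relation_ideal: "f \<in> tgw_relation_ideal h t \<Longrightarrow> rescale \<psi> c f \<in> tgw_relation_ideal h' t'"
  using tgw_relation_ideal_least [OF rescale.two_sided_ideal_vimage [OF B.two_sided_ideal_axioms]]
    rescale_relation by blast

end

locale TGW_isomorphism =
  F: TGW_morphism h t h' t' \<psi> c + G: TGW_morphism h' t' h t \<psi>' c'
  for h :: "'n::finite \<Rightarrow> 'r::comm_ring_1 \<Rightarrow> 'r" and t :: "'n \<Rightarrow> 'r"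
    and h' :: "'n \<Rightarrow> 'r \<Rightarrow> 'r" and t' :: "'n \<Rightarrow> 'r"
    and \<psi> :: "'r \<Rightarrow> 'r" and c :: "'n \<Rightarrow> 'r" and \<psi>' :: "'r \<Rightarrow> 'r" and c' :: "'n \<Rightarrow> 'r" +
  assumes inverse: "\<psi>' (\<psi> r) = r" "\<psi> (\<psi>' r) = r"
    and scale_inverse: "\<psi>' (c i) * c' i = 1" "\<psi> (c' i) * c i = 1"
begin

lemma rescale_rescale: "F.A.cong (rescale \<psi>' c' (rescale \<psi> c f)) f"
proof (induction f rule: poly_mapping_add_induct)
  case (single w k)
  have letter: "F.A.cong (rescale \<psi>' c' (letter_map \<psi> c x)) (gen x)" for x
  proof (cases x)
    case (Xgen e i)
    have "F.A.cong (gen (Coef (\<psi>' (c i))) * gen (Coef (c' i))) (gen (Coef (\<psi>' (c i) * c' i)))"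
      by (rule F.A.cong_sym [OF F.A.coef_mult_cong])
    also have "F.A.cong \<dots> 1"
      using F.A.coef_one_cong by (simp add: scale_inverse)
    finally have "F.A.cong (gen (Coef (\<psi>' (c i))) * gen (Coef (c' i)) * gen (Xgen Pos i)) (1 * gen (Xgen Pos i))"
      by (rule F.A.cong_rmult)
    with Xgen show ?thesis by (cases e) (simp_all add: mult.assoc)
  qed (use inverse in auto)
  have word: "F.A.cong (rescale \<psi>' c' (rescale \<psi> c (Poly_Mapping.single (Word ls) 1)))
      (Poly_Mapping.single (Word ls) 1)" for ls
  proof (induction ls)
    case Nil
    then show ?case by (simp flip: zero_word_def)
  next
    case (Cons l ls)
    then show ?case
      unfolding single_word_Cons rescale.mult rescale_gen by (intro F.A.cong_mult letter)
  qed
  have "F.A.cong (of_int k * rescale \<psi>' c' (rescale \<psi> c (Poly_Mapping.single w 1)))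
      (of_int k * Poly_Mapping.single w 1)"
    using word [of "letters w"] by (intro F.A.cong_lmult) simp
  then show ?case
    by (subst (1 2) single_word_coefficient) (simp only: rescale.mult rescale_of_int)
next
  case (add f g)
  then show ?case by (simp only: rescale.add F.A.cong_add)
qed

lemma swap: "TGW_isomorphism h' t' h t \<psi>' c' \<psi> c"
  using inverse scale_inverse
  by (intro TGW_isomorphism.intro TGW_isomorphism_axioms.intro F.TGW_morphism_axioms G.TGW_morphism_axioms) auto

lemma rescale_TGW_null:
  assumes "f \<in> TGW_null h t"
  shows "rescale \<psi> c f \<in> TGW_null h' t'"
  unfolding TGW_null_def
proof (intro CollectI allI impI)
  interpret swap: TGW_isomorphism h' t' h t \<psi>' c' \<psi> c by (rule swap)
  fix d and v w :: "('n, 'r) letter word"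
  assume deg: "word_degree v + d + word_degree w = 0"
  let ?v = "rescale \<psi>' c' (Poly_Mapping.single v 1)" and ?w = "rescale \<psi>' c' (Poly_Mapping.single w 1)"
  have "rescale \<psi> c (?v * homogeneous_part d f * ?w) \<in> tgw_relation_ideal h' t'"
    using TGW_null_homogeneous [OF assms homogeneous_rescale_word homogeneous_rescale_word deg]
    by (rule F.rescale_relation_ideal)
  moreover have "F.B.cong (rescale \<psi> c (?v * homogeneous_part d f * ?w))
      (Poly_Mapping.single v 1 * homogeneous_part d (rescale \<psi> c f) * Poly_Mapping.single w 1)"
    unfolding rescale.mult homogeneous_part_rescale
    by (intro F.B.cong_mult swap.rescale_rescale F.B.cong_refl)
  ultimately show "Poly_Mapping.single v 1 * homogeneous_part d (rescale \<psi> c f) * Poly_Mapping.single w 1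
      \<in> tgw_relation_ideal h' t'"
    using F.B.cong_mem by blast
qed

lemma TGWA_map_rescale_rescale: "TGWA_map h t (rescale \<psi>' c' (rescale \<psi> c f)) = TGWA_map h t f"
  by (rule F.A.TGWA_map_cong [OF rescale_rescale])

lemma graded_isomorphism:
  obtains \<phi> where "\<phi> \<in> ring_iso (TGWA h t) (TGWA h' t')"
    and "\<And>f. \<phi> (TGWA_map h t f) = TGWA_map h' t' (rescale \<psi> c f)"
    and "\<And>d. \<phi> ` TGWA_component h t d = TGWA_component h' t' d"
proof -
  interpret swap: TGW_isomorphism h' t' h t \<psi>' c' \<psi> c by (rule swap)
  define \<phi> where "\<phi> x = TGWA_map h' t' (rescale \<psi> c (SOME f. TGWA_map h t f = x))" for x
  have eq_iff: "TGWA_map h' t' (rescale \<psi> c f) = TGWA_map h' t' (rescale \<psi> c g) \<longleftrightarrow>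
      TGWA_map h t f = TGWA_map h t g" for f g
  proof
    assume "TGWA_map h t f = TGWA_map h t g"
    then show "TGWA_map h' t' (rescale \<psi> c f) = TGWA_map h' t' (rescale \<psi> c g)"
      using rescale_TGW_null [of "f - g"] by (simp add: TGWA_map_eq_iff)
  next
    assume "TGWA_map h' t' (rescale \<psi> c f) = TGWA_map h' t' (rescale \<psi> c g)"
    then have "rescale \<psi>' c' (rescale \<psi> c f) - rescale \<psi>' c' (rescale \<psi> c g) \<in> TGW_null h t"
      using swap.rescale_TGW_null [of "rescale \<psi> c f - rescale \<psi> c g"] by (simp add: TGWA_map_eq_iff)
    then show "TGWA_map h t f = TGWA_map h t g"
      unfolding TGWA_map_eq_iff [symmetric] TGWA_map_rescale_rescale .
  qed
  have phi: "\<phi> (TGWA_map h t f) = TGWA_map h' t' (rescale \<psi> c f)" for f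
    unfolding \<phi>_def eq_iff by (rule someI) (rule refl)
  have "\<phi> \<in> ring_hom (TGWA h t) (TGWA h' t')"
    by (auto simp: ring_hom_def carrier_TGWA phi simp flip: TGWA_map_simps)
  moreover have "bij_betw \<phi> (carrier (TGWA h t)) (carrier (TGWA h' t'))"
  proof (rule bij_betw_imageI)
    show "inj_on \<phi> (carrier (TGWA h t))"
      by (auto simp: inj_on_def carrier_TGWA phi eq_iff)
    show "\<phi> ` carrier (TGWA h t) = carrier (TGWA h' t')"
    proof
      show "carrier (TGWA h' t') \<subseteq> \<phi> ` carrier (TGWA h t)"
      proof
        fix y assume "y \<in> carrier (TGWA h' t')"
        then obtain g where "y = TGWA_map h' t' g" by (auto simp: carrier_TGWA)
        then have "y = \<phi> (TGWA_map h t (rescale \<psi>' c' g))"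
          by (simp add: phi swap.TGWA_map_rescale_rescale)
        then show "y \<in> \<phi> ` carrier (TGWA h t)" by simp
      qed
    qed (auto simp: carrier_TGWA phi)
  qed
  ultimately have "\<phi> \<in> ring_iso (TGWA h t) (TGWA h' t')"
    by (simp add: ring_iso_def)
  moreover have "\<phi> ` TGWA_component h t d = TGWA_component h' t' d" for d
  proof
    show "\<phi> ` TGWA_component h t d \<subseteq> TGWA_component h' t' d"
      by (auto simp: TGWA_component_eq phi homogeneous_rescale)
    show "TGWA_component h' t' d \<subseteq> \<phi> ` TGWA_component h t d"
    proof
      fix y assume "y \<in> TGWA_component h' t' d"
      then obtain g where g: "y = TGWA_map h' t' g" "homogeneous d g" by (auto simp: TGWA_component_eq)
      then have "y = \<phi> (TGWA_map h t (rescale \<psi>' c' g))"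
        by (simp add: phi swap.TGWA_map_rescale_rescale)
      then show "y \<in> \<phi> ` TGWA_component h t d"
        using homogeneous_rescale [OF g(2)] by (auto simp: TGWA_component_eq)
    qed
  qed
  ultimately show thesis
    using that phi by blast
qed

end

section \<open>Graded isomorphisms restrict to the base ring\<close>

locale TGW_graded_iso = A: TGW_relations h t + B: TGW_relations h' t'
  for h :: "'n::finite \<Rightarrow> 'r::comm_ring_1 \<Rightarrow> 'r" and t :: "'n \<Rightarrow> 'r"
    and h' :: "'n \<Rightarrow> 'r \<Rightarrow> 'r" and t' :: "'n \<Rightarrow> 'r" +
  fixes \<phi> :: "('n, 'r) letter free_ring set set \<Rightarrow> ('n, 'r) letter free_ring set set"
  assumes iso: "\<phi> \<in> ring_iso (TGWA h t) (TGWA h' t')"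
    and components: "\<phi> ` TGWA_component h t d = TGWA_component h' t' d"
    and coef_injective: "gen (Coef r) \<in> tgw_relation_ideal h t \<Longrightarrow> r = 0"
    and coef_injective': "gen (Coef r) \<in> tgw_relation_ideal h' t' \<Longrightarrow> r = 0"
begin

abbreviation q :: "('n, 'r) letter free_ring \<Rightarrow> ('n, 'r) letter free_ring set set"
  where "q \<equiv> TGWA_map h t"

abbreviation q' :: "('n, 'r) letter free_ring \<Rightarrow> ('n, 'r) letter free_ring set set"
  where "q' \<equiv> TGWA_map h' t'"

abbreviation coef :: "'r \<Rightarrow> ('n, 'r) letter free_ring"
  where "coef r \<equiv> gen (Coef r)"

abbreviation xgen :: "sign \<Rightarrow> 'n \<Rightarrow> ('n, 'r) letter free_ring"
  where "xgen e i \<equiv> gen (Xgen e i)"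

lemma phi_hom: "\<phi> \<in> ring_hom (TGWA h t) (TGWA h' t')"
  using iso by (simp add: ring_iso_def)

lemma phi_one: "\<phi> (q 1) = q' 1"
  using ring_hom_one [OF phi_hom] by (simp add: TGWA_map_simps)

lemma phi_add: "\<phi> (q f) = q' f' \<Longrightarrow> \<phi> (q g) = q' g' \<Longrightarrow> \<phi> (q (f + g)) = q' (f' + g')"
  using ring_hom_add [OF phi_hom TGWA_map_carrier TGWA_map_carrier, of f g] by (simp add: TGWA_map_simps)

lemma phi_mult: "\<phi> (q f) = q' f' \<Longrightarrow> \<phi> (q g) = q' g' \<Longrightarrow> \<phi> (q (f * g)) = q' (f' * g')"
  using ring_hom_mult [OF phi_hom TGWA_map_carrier TGWA_map_carrier, of f g] by (simp add: TGWA_map_simps)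

lemma q'_mult: "q' f = q' f' \<Longrightarrow> q' g = q' g' \<Longrightarrow> q' (f * g) = q' (f' * g')"
  by (simp add: TGWA_map_simps)

lemma phi_inj: "\<phi> (q f) = \<phi> (q g) \<Longrightarrow> q f = q g"
  using iso by (auto simp: ring_iso_def bij_betw_def dest: inj_onD)

lemma q_coef_inj: "q (coef r) = q (coef s) \<longleftrightarrow> r = s"
  using A.TGWA_map_coef_eqD [of r s] coef_injective [of "r - s"] by auto

lemma q'_coef_inj: "q' (coef r) = q' (coef s) \<longleftrightarrow> r = s"
  using B.TGWA_map_coef_eqD [of r s] coef_injective' [of "r - s"] by auto

lemma phi_homogeneous:
  assumes "homogeneous d f"
  obtains g where "homogeneous d g" and "\<phi> (q f) = q' g"
proof -
  have "\<phi> (q f) \<in> \<phi> ` TGWA_component h t d"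
    using assms by (auto simp: TGWA_component_eq)
  then show thesis
    unfolding components using that by (auto simp: TGWA_component_eq)
qed

lemma phi_homogeneous_surj:
  assumes "homogeneous d g"
  obtains f where "homogeneous d f" and "\<phi> (q f) = q' g"
proof -
  have "q' g \<in> \<phi> ` TGWA_component h t d"
    unfolding components using assms by (auto simp: TGWA_component_eq)
  then show thesis
    using that by (auto simp: TGWA_component_eq)
qed

definition \<psi> :: "'r \<Rightarrow> 'r"
  where "\<psi> r = (SOME s. \<phi> (q (coef r)) = q' (coef s))"

lemma phi_coef: "\<phi> (q (coef r)) = q' (coef (\<psi> r))"
proof -
  obtain g where g: "homogeneous 0 g" "\<phi> (q (coef r)) = q' g"
    using phi_homogeneous [OF homogeneous_gen_Coef] .
  then obtain s where "B.cong g (coef s)"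
    using B.homogeneous_zero_cong by blast
  then have "\<phi> (q (coef r)) = q' (coef s)"
    using g B.TGWA_map_cong by simp
  then show ?thesis
    unfolding \<psi>_def by (rule someI)
qed

lemma psi_eqI: "\<phi> (q (coef r)) = q' (coef s) \<Longrightarrow> \<psi> r = s"
  by (simp add: phi_coef q'_coef_inj)

lemma unital_hom_psi: "unital_hom \<psi>"
proof
  show "\<psi> 1 = 1"
    by (rule psi_eqI) (use phi_one A.TGWA_map_cong [OF A.coef_one_cong] B.TGWA_map_cong [OF B.coef_one_cong] in simp)
  show "\<psi> (r + s) = \<psi> r + \<psi> s" for r s
    by (rule psi_eqI)
      (simp only: A.TGWA_map_cong [OF A.coef_add_cong] B.TGWA_map_cong [OF B.coef_add_cong] phi_add [OF phi_coef phi_coef])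
  show "\<psi> (r * s) = \<psi> r * \<psi> s" for r s
    by (rule psi_eqI)
      (simp only: A.TGWA_map_cong [OF A.coef_mult_cong] B.TGWA_map_cong [OF B.coef_mult_cong] phi_mult [OF phi_coef phi_coef])
qed

lemma bij_psi: "bij \<psi>"
proof (rule bijI)
  show "inj \<psi>"
    by (rule injI) (metis phi_coef phi_inj q_coef_inj)
  show "surj \<psi>"
  proof (rule surjI)
    fix s
    obtain f where f: "homogeneous 0 f" "\<phi> (q f) = q' (coef s)"
      using phi_homogeneous_surj [OF homogeneous_gen_Coef] .
    then obtain r where "A.cong f (coef r)"
      using A.homogeneous_zero_cong by blast
    then have "\<psi> r = s"
      using f A.TGWA_map_cong by (intro psi_eqI) simp
    then show "\<psi> (SOME r. \<psi> r = s) = s"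
      by (rule someI)
  qed
qed

lemma phi_xgen: "\<exists>a. \<phi> (q (xgen e i)) = q' (coef a * xgen e i)"
proof -
  obtain g where g: "homogeneous (letter_degree (Xgen e i :: ('n, 'r) letter)) g" "\<phi> (q (xgen e i)) = q' g"
    using phi_homogeneous [OF homogeneous_gen] .
  then show ?thesis
    using B.homogeneous_X_cong B.TGWA_map_cong by metis
qed

lemma phi_xgen_surj: "\<exists>b. \<phi> (q (coef b * xgen e i)) = q' (xgen e i)"
proof -
  obtain f where f: "homogeneous (letter_degree (Xgen e i :: ('n, 'r) letter)) f" "\<phi> (q f) = q' (xgen e i)"
    using phi_homogeneous_surj [OF homogeneous_gen] .
  then show ?thesis
    using A.homogeneous_X_cong A.TGWA_map_cong by metis
qed

lemma q'_xgen_cancel: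
  assumes "q' (coef a * xgen e i) = q' (coef b * xgen e i)"
  shows "a * half h' e i (t' i) = b * half h' e i (t' i)"
proof -
  have "q' (coef r * xgen e i * xgen (opp e) i) = q' (coef (r * half h' e i (t' i)))" for r
    unfolding mult.assoc
    by (intro B.TGWA_map_cong B.cong_trans [OF B.cong_lmult [OF B.X_same_cong] B.cong_sym [OF B.coef_mult_cong]])
  then show ?thesis
    using q'_mult [OF assms refl, of "xgen (opp e) i"] by (simp add: q'_coef_inj)
qed

lemma phi_xgen_unit:
  assumes "\<phi> (q (xgen e i)) = q' (coef a * xgen e i)"
  obtains b where "\<psi> b * a * half h' e i (t' i) = half h' e i (t' i)"
proof -
  obtain b where "\<phi> (q (coef b * xgen e i)) = q' (xgen e i)"
    using phi_xgen_surj by blast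
  moreover have "\<phi> (q (coef b * xgen e i)) = q' (coef (\<psi> b) * (coef a * xgen e i))"
    by (rule phi_mult [OF phi_coef assms])
  moreover have "q' (coef (\<psi> b) * (coef a * xgen e i)) = q' (coef (\<psi> b * a) * xgen e i)"
    unfolding mult.assoc [symmetric] by (intro B.TGWA_map_cong B.cong_rmult B.cong_sym [OF B.coef_mult_cong])
  moreover have "q' (xgen e i) = q' (coef 1 * xgen e i)"
    using B.TGWA_map_cong [OF B.cong_rmult [OF B.coef_one_cong]] by simp
  ultimately have "q' (coef (\<psi> b * a) * xgen e i) = q' (coef 1 * xgen e i)"
    by simp
  from q'_xgen_cancel [OF this] show thesis
    using that by simp
qed

lemma phi_xgen_coef:
  assumes "\<phi> (q (xgen e i)) = q' (coef a * xgen e i)" and "\<psi> (half h (opp e) i r) = half h' (opp e) i s"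
  shows "a * half h' e i s * half h' e i (t' i) = \<psi> (half h e i r) * a * half h' e i (t' i)"
proof (rule q'_xgen_cancel)
  have "q' (coef (\<psi> (half h e i r) * a) * xgen e i) = q' (coef (\<psi> (half h e i r)) * (coef a * xgen e i))"
    unfolding mult.assoc [symmetric] by (intro B.TGWA_map_cong B.cong_rmult B.coef_mult_cong)
  also have "\<dots> = \<phi> (q (coef (half h e i r) * xgen e i))"
    by (rule phi_mult [OF phi_coef assms(1), symmetric])
  also have "\<dots> = \<phi> (q (xgen e i * coef (half h (opp e) i r)))"
    using A.TGWA_map_cong [OF A.X_coef_cong] by simp
  also have "\<dots> = q' (coef a * xgen e i * coef (half h' (opp e) i s))"
    by (rule phi_mult [OF assms(1)]) (simp add: phi_coef assms(2))
  also have "\<dots> = q' (coef a * coef (half h' e i s) * xgen e i)"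
    unfolding mult.assoc by (intro B.TGWA_map_cong B.cong_lmult B.X_coef_cong)
  also have "\<dots> = q' (coef (a * half h' e i s) * xgen e i)"
    by (intro B.TGWA_map_cong B.cong_rmult B.cong_sym [OF B.coef_mult_cong])
  finally show "q' (coef (a * half h' e i s) * xgen e i) = q' (coef (\<psi> (half h e i r) * a) * xgen e i)"
    by (rule sym)
qed

lemma phi_xgen_same:
  assumes "\<phi> (q (xgen e i)) = q' (coef a * xgen e i)" and "\<phi> (q (xgen (opp e) i)) = q' (coef b * xgen (opp e) i)"
    and fixed: "half h' e i b = b" "half h' (opp e) i b = b"
  shows "\<psi> (half h e i (t i)) = a * b * half h' e i (t' i)"
proof (rule psi_eqI)
  have "\<phi> (q (coef (half h e i (t i)))) = \<phi> (q (xgen e i * xgen (opp e) i))"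
    using A.TGWA_map_cong [OF A.X_same_cong] by simp
  also have "\<dots> = q' (coef a * xgen e i * (coef b * xgen (opp e) i))"
    by (rule phi_mult [OF assms(1,2)])
  also have "\<dots> = q' (coef a * (xgen e i * coef b) * xgen (opp e) i)"
    by (simp add: mult.assoc)
  also have "\<dots> = q' (coef a * (coef b * xgen e i) * xgen (opp e) i)"
    using B.X_coef_cong [of e i b] unfolding fixed by (intro B.TGWA_map_cong B.cong_rmult B.cong_lmult)
  also have "\<dots> = q' (coef a * coef b * (xgen e i * xgen (opp e) i))"
    by (simp add: mult.assoc)
  also have "\<dots> = q' (coef (a * b) * coef (half h' e i (t' i)))"
    by (intro B.TGWA_map_cong B.cong_mult B.cong_sym [OF B.coef_mult_cong] B.X_same_cong)
  also have "\<dots> = q' (coef (a * b * half h' e i (t' i)))"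
    by (intro B.TGWA_map_cong B.cong_sym [OF B.coef_mult_cong])
  finally show "\<phi> (q (coef (half h e i (t i)))) = q' (coef (a * b * half h' e i (t' i)))" .
qed

end

lemma half_shift_half_shift: "half_shift \<alpha> i (half_shift \<alpha> i r) = shift (\<alpha> :: 'k::field_char_0 ^ 'n ^ 'm::finite) i r"
  by (simp add: half_shift_def shift_def translation_translation)

lemma half_half_shift_hom: "unital_hom (half (half_shift \<alpha>) e i)"
  by (cases e) (simp_all only: half_half_shift unital_hom_translation)

lemma half_half_shift_Const: "half (half_shift \<alpha>) e i (Const c) = Const c"
  by (cases e) (simp_all only: half_half_shift translation_Const)

lemma bij_half_shift: "bij (half_shift \<alpha> i)"
  unfolding half_shift_def by (rule bij_translation)

lemma inj_half_half_shift: "inj (half (half_shift \<alpha>) e i)"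
  by (cases e) (simp_all only: half_half_shift bij_is_inj [OF bij_translation])

lemma half_shift_intertwine:
  fixes \<alpha> \<alpha>' :: "'k::field_char_0 ^ 'n ^ 'm::finite"
  assumes "unital_hom \<psi>" and "\<And>f. \<psi> (shift \<alpha> i f) = shift \<alpha>' i (\<psi> f)"
  shows "\<psi> (half (half_shift \<alpha>) e i f) = half (half_shift \<alpha>') e i (\<psi> f)"
proof -
  have pos: "\<psi> (half_shift \<alpha> i f) = half_shift \<alpha>' i (\<psi> f)" for f
    unfolding half_shift_def
    by (rule intertwine_half [OF assms(1)]) (use assms(2) in \<open>simp add: shift_def\<close>)
  show ?thesis
  proof (cases e)
    case Neg
    have "half_shift \<alpha>' i (\<psi> (half (half_shift \<alpha>) Neg i f)) = \<psi> f"
      unfolding pos [symmetric] using bij_half_shift [of \<alpha> i]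
      by (simp add: bij_is_surj surj_f_inv_f)
    then have "half (half_shift \<alpha>') Neg i (\<psi> f) = \<psi> (half (half_shift \<alpha>) Neg i f)"
      using bij_half_shift [of \<alpha>' i] by (metis bij_is_inj half.simps(2) inv_f_f)
    with Neg show ?thesis by simp
  qed (simp add: pos)
qed

lemma TGW_relations_half_shift: "TGW_relations (half_shift \<alpha>)"
  by unfold_locales (rule bij_half_shift)

lemma graded_isomorphic_imp_equivalent:
  fixes \<alpha> \<alpha>' :: "'k::field_char_0 ^ 'n::finite ^ 'm::finite"
    and p p' :: "'n \<Rightarrow> ('m, 'k) mpoly" and ord :: "('m \<Rightarrow>\<^sub>0 nat) rel"
  assumes "monomial_order ord"
    and "tgw_datum (half_shift \<alpha>) p" and "consistent (half_shift \<alpha>) p"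
    and "tgw_datum (half_shift \<alpha>') p'" and "consistent (half_shift \<alpha>') p'"
    and "graded_algebra_isomorphic (half_shift \<alpha>) p (half_shift \<alpha>') p'"
  shows "equivalent_pairs \<alpha> p \<alpha>' p'"
proof -
  let ?h = "half (half_shift \<alpha>)" and ?h' = "half (half_shift \<alpha>')"
  obtain \<phi> where iso: "\<phi> \<in> ring_iso (TGWA (half_shift \<alpha>) p) (TGWA (half_shift \<alpha>') p')"
    and const: "\<And>c. \<phi> (TGWA_of_coef (half_shift \<alpha>) p (Const c)) = TGWA_of_coef (half_shift \<alpha>') p' (Const c)"
    and comp: "\<And>d. \<phi> ` TGWA_component (half_shift \<alpha>) p d = TGWA_component (half_shift \<alpha>') p' d"
    using assms(6) unfolding graded_algebra_isomorphic_def by blast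
  interpret TGW_graded_iso "half_shift \<alpha>" p "half_shift \<alpha>'" p' \<phi>
    using iso comp TGW_Coef_injective [OF assms(2,3)] TGW_Coef_injective [OF assms(4,5)]
    by (intro TGW_graded_iso.intro TGW_graded_iso_axioms.intro TGW_relations_half_shift)
  interpret \<psi>: unital_hom \<psi> by (rule unital_hom_psi)
  have p'_nonzero: "?h' e i (p' i) \<noteq> 0" for e i
  proof -
    interpret half: unital_hom "?h' e i" by (rule half_half_shift_hom)
    show ?thesis
      using assms(4) inj_half_half_shift [of \<alpha>' e i] by (metis half.zero injD tgw_datum_def)
  qed
  have cancel: "x = y" if "x * ?h' e i (p' i) = y * ?h' e i (p' i)" for x y e i
    using that p'_nonzero [of e i] mpoly_mult_eq_0_iff [of "x - y" "?h' e i (p' i)"]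
    by (simp add: left_diff_distrib)
  have psi_Const: "\<psi> (Const c) = Const c" for c
    using const by (intro psi_eqI) (simp add: TGWA_of_coef_eq)
  have "\<exists>a. a \<noteq> 0 \<and> \<phi> (q (xgen e i)) = q' (coef (Const a) * xgen e i)" for e i
  proof -
    obtain a where a: "\<phi> (q (xgen e i)) = q' (coef a * xgen e i)"
      using phi_xgen by blast
    then obtain b where "\<psi> b * a * ?h' e i (p' i) = ?h' e i (p' i)"
      by (rule phi_xgen_unit)
    then have "a * \<psi> b = 1"
      using cancel [of "\<psi> b * a" e i 1] by (simp add: mult.commute)
    then obtain c where "c \<noteq> 0" "a = Const c"
      by (rule mpoly_unit_imp_Const [OF assms(1)])
    with a show ?thesis by blast
  qed
  then obtain a where a: "\<And>e i. a e i \<noteq> 0"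
    and phi_a: "\<And>e i. \<phi> (q (xgen e i)) = q' (coef (Const (a e i)) * xgen e i)"
    by metis
  have shift: "\<psi> (shift \<alpha> i f) = shift \<alpha>' i (\<psi> f)" for i f
  proof -
    have inv: "?h Neg i (half_shift \<alpha> i f) = f" "?h' Neg i (half_shift \<alpha>' i (\<psi> f)) = \<psi> f"
      by (simp_all add: bij_half_shift [THEN bij_is_inj])
    have "Const (a Pos i) * ?h' Pos i (half_shift \<alpha>' i (\<psi> f)) * ?h' Pos i (p' i) =
        \<psi> (?h Pos i (half_shift \<alpha> i f)) * Const (a Pos i) * ?h' Pos i (p' i)"
      by (rule phi_xgen_coef [OF phi_a]) (use inv in simp)
    then have "Const (a Pos i) * shift \<alpha>' i (\<psi> f) = Const (a Pos i) * \<psi> (shift \<alpha> i f)"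
      using cancel by (fastforce simp: half_shift_half_shift mult.commute)
    then have "Const (a Pos i) * (shift \<alpha>' i (\<psi> f) - \<psi> (shift \<alpha> i f)) = 0"
      by (simp add: right_diff_distrib)
    moreover have "Const (a Pos i) \<noteq> (Const 0 :: ('m, 'k) mpoly)"
      unfolding Const_eq_iff by (rule a)
    ultimately show ?thesis
      by (simp add: mpoly_mult_eq_0_iff)
  qed
  have "\<psi> (p i) = Const (a Pos i * a Neg i) * p' i" for i
  proof -
    interpret half: unital_hom "?h' Pos i" by (rule half_half_shift_hom)
    interpret C: unital_hom "Const :: 'k \<Rightarrow> ('m, 'k) mpoly" by (rule unital_hom_Const)
    have "?h' Pos i (\<psi> (p i)) = \<psi> (?h Pos i (p i))"
      by (rule half_shift_intertwine [OF unital_hom_psi shift, symmetric])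
    also have "\<dots> = Const (a Pos i) * Const (a Neg i) * ?h' Pos i (p' i)"
      using phi_a [of Pos] phi_a [of Neg] by (intro phi_xgen_same) (simp_all only: opp.simps half_half_shift_Const)
    also have "\<dots> = ?h' Pos i (Const (a Pos i * a Neg i) * p' i)"
      by (simp only: half.mult half_half_shift_Const C.mult)
    finally show ?thesis
      using inj_half_half_shift by (rule injD [rotated])
  qed
  moreover have "algebra_automorphism \<psi>"
    using bij_psi psi_Const by (simp add: algebra_automorphism_def ring_automorphism_def)
  ultimately show ?thesis
    unfolding equivalent_pairs_def using shift a
    by (intro exI [of _ \<psi>] conjI allI ext) (auto intro!: exI [of _ "a Pos i * a Neg i" for i])
qed

lemma equivalent_imp_graded_isomorphic:
  fixes \<alpha> \<alpha>' :: "'k::field_char_0 ^ 'n::finite ^ 'm::finite"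
    and p p' :: "'n \<Rightarrow> ('m, 'k) mpoly"
  assumes "equivalent_pairs \<alpha> p \<alpha>' p'"
  shows "graded_algebra_isomorphic (half_shift \<alpha>) p (half_shift \<alpha>') p'"
proof -
  let ?h = "half (half_shift \<alpha>)" and ?h' = "half (half_shift \<alpha>')"
  obtain \<psi> where "algebra_automorphism \<psi>" and \<psi>: "\<forall>i. \<psi> \<circ> shift \<alpha> i = shift \<alpha>' i \<circ> \<psi> \<and> (\<exists>c. c \<noteq> 0 \<and> \<psi> (p i) = Const c * p' i)"
    using assms unfolding equivalent_pairs_def by blast
  then have bij: "bij \<psi>" and hom: "unital_hom \<psi>" and psi_Const: "\<And>c. \<psi> (Const c) = Const c"
    by (auto simp: algebra_automorphism_def ring_automorphism_def unital_hom_def)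
  obtain c where c: "\<And>i. c i \<noteq> 0" and psi_p: "\<And>i. \<psi> (p i) = Const (c i) * p' i"
    using \<psi> by metis
  interpret \<psi>: unital_hom \<psi> by (rule hom)
  interpret C: unital_hom "Const :: 'k \<Rightarrow> ('m, 'k) mpoly" by (rule unital_hom_Const)
  define \<psi>' where "\<psi>' = inv_into UNIV \<psi>"
  have inverse: "\<psi>' (\<psi> f) = f" "\<psi> (\<psi>' f) = f" for f
    using bij by (simp_all add: \<psi>'_def bij_is_inj bij_is_surj surj_f_inv_f)
  have psi'_eqI: "\<psi>' f = g" if "f = \<psi> g" for f g
    using that inverse by simp
  have half: "\<psi> (?h e i f) = ?h' e i (\<psi> f)" for e i f
    using \<psi> by (intro half_shift_intertwine hom) (auto simp: fun_eq_iff)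
  have scale: "\<psi> (?h e i (p i)) = Const (c i) * ?h' e i (p' i)" for e i
  proof -
    interpret half: unital_hom "?h' e i" by (rule half_half_shift_hom)
    show ?thesis by (simp only: half psi_p half.mult half_half_shift_Const)
  qed
  have inv_Const: "Const (inverse (c i)) * (Const (c i) * f) = f" for f :: "('m, 'k) mpoly" and i
    using c by (simp flip: mult.assoc C.mult)
  interpret TGW_isomorphism "half_shift \<alpha>" p "half_shift \<alpha>'" p' \<psi> "\<lambda>i. Const (c i)" \<psi>' "\<lambda>i. Const (inverse (c i))"
  proof (intro TGW_isomorphism.intro TGW_isomorphism_axioms.intro TGW_morphism.intro TGW_morphism_axioms.intro
      TGW_relations_half_shift hom half scale half_half_shift_Const inverse)
    show "unital_hom \<psi>'"
      by unfold_locales (auto intro!: psi'_eqI simp: inverse)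
    show "\<psi>' (?h' e i f) = ?h e i (\<psi>' f)" for e i f
      by (rule psi'_eqI) (simp only: half inverse)
    show "\<psi>' (?h' e i (p' i)) = Const (inverse (c i)) * ?h e i (p i)" for e i
      by (rule psi'_eqI) (simp only: \<psi>.mult scale psi_Const inv_Const)
    show "\<psi>' (Const (c i)) * Const (inverse (c i)) = 1" "\<psi> (Const (inverse (c i))) * Const (c i) = 1" for i
      using c by (simp_all add: psi'_eqI [OF psi_Const [symmetric]] psi_Const flip: C.mult)
  qed
  obtain \<phi> where "\<phi> \<in> ring_iso (TGWA (half_shift \<alpha>) p) (TGWA (half_shift \<alpha>') p')"
    and "\<And>f. \<phi> (TGWA_map (half_shift \<alpha>) p f) = TGWA_map (half_shift \<alpha>') p' (rescale \<psi> (\<lambda>i. Const (c i)) f)"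
    and "\<And>d. \<phi> ` TGWA_component (half_shift \<alpha>) p d = TGWA_component (half_shift \<alpha>') p' d"
    using graded_isomorphism by blast
  then show ?thesis
    unfolding graded_algebra_isomorphic_def
    by (intro bexI [of _ \<phi>]) (simp_all add: TGWA_of_coef_eq psi_Const)
qed

theorem corollary2p11:
  fixes \<alpha> \<alpha>' :: "'k::field_char_0 ^ 'n::finite ^ 'm::finite"
    and p p' :: "'n \<Rightarrow> ('m, 'k) mpoly"
    and ord :: "('m \<Rightarrow>\<^sub>0 nat) rel"
  assumes "monomial_order ord"
    and "\<And>i. monic ord (p i)" and "\<And>i. monic ord (p' i)"
    and "tgw_datum (half_shift \<alpha>) p" and "consistent (half_shift \<alpha>) p"
    and "tgw_datum (half_shift \<alpha>') p'" and "consistent (half_shift \<alpha>') p'"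
  shows "graded_algebra_isomorphic (half_shift \<alpha>) p (half_shift \<alpha>') p' \<longleftrightarrow>
    equivalent_pairs \<alpha> p \<alpha>' p'"
  using graded_isomorphic_imp_equivalent [OF assms(1,4-7)] equivalent_imp_graded_isomorphic by blast

end
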